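(* Let $\rho$ be an ergodic and positively associated probability measure on $\{0,1\}^{\mathbb{Z}^2}$ satisfying the finite energy condition. Then the $\rho$-probability of coexistence of an infinite $1*$cluster and an infinite $0$cluster is zero.
   Context: $\{0,1\}^{\mathbb{Z}^2}$ carries the $\sigma$-algebra generated by the cylinder sets. Ergodicity always refers to the translations of $\mathbb{Z}^2$ and includes translation invariance. Two nodes of $\mathbb{Z}^2$ are adjacent if their Euclidean distance is $1$, and $*$adjacent if it is $1$ or $\sqrt2$. For a configuration $\sigma\in\{0,1\}^{\mathbb{Z}^2}$, a $0$cluster is a maximal subset of $\sigma^{-1}(0)$ that is connected with respect to adjacency; a $1*$cluster is a maximal subset of $\sigma^{-1}(1)$ that is connected with respect to $*$adjacency. An event $A\subset\{0,1\}^{\mathbb{Z}^2}$ is increasing if $\xi\in A$ and $\eta\ge\xi$ (pointwise) imply $\eta\in A$. A probability measure $\rho$ on $\{0,1\}^{\mathbb{Z}^2}$ is positively associated if $\rho(A\cap B)\ge\rho(A)\rho(B)$ for all increasing events $A,B$. A probability measure $\rho$ on $\{0,1\}^{\mathbb{Z}^2}$ satisfies the finite energy condition if, for every finite set $\Delta\subset\mathbb{Z}^2$, $\rho(\eta\text{ on }\Delta\mid\xi\text{ off }\Delta)>0$ for all $\eta\in\{0,1\}^{\Delta}$ and $\rho$-a.e. $\xi\in\{0,1\}^{\Delta^c}$. *)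

theory Defs
  imports "HOL-Probability.Probability"
begin

type_synonym site = "int \<times> int"

text \<open>The spin values 0 and 1 are encoded as \<^const>\<open>False\<close> and \<^const>\<open>True\<close>, so that the
  order on functions is the pointwise order of configurations.\<close>

type_synonym config = "site \<Rightarrow> bool"

definition config_space :: "config measure" where
  "config_space = (\<Pi>\<^sub>M x\<in>UNIV. count_space UNIV)"

text \<open>The product metric on \<^typ>\<open>real \<times> real\<close> is the Euclidean one.\<close>

definition site_dist :: "site \<Rightarrow> site \<Rightarrow> real" where
  "site_dist x y =
     dist (real_of_int (fst x), real_of_int (snd x)) (real_of_int (fst y), real_of_int (snd y))"

definition adjacent :: "site \<Rightarrow> site \<Rightarrow> bool" where
  "adjacent x y \<longleftrightarrow> site_dist x y = 1"

definition star_adjacent :: "site \<Rightarrow> site \<Rightarrow> bool" where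
  "star_adjacent x y \<longleftrightarrow> site_dist x y = 1 \<or> site_dist x y = sqrt 2"

definition connected_wrt :: "(site \<Rightarrow> site \<Rightarrow> bool) \<Rightarrow> site set \<Rightarrow> bool" where
  "connected_wrt R S \<longleftrightarrow>
     (\<forall>x\<in>S. \<forall>y\<in>S. (\<lambda>u v. u \<in> S \<and> v \<in> S \<and> R u v)\<^sup>*\<^sup>* x y)"

definition maximal_connected :: "(site \<Rightarrow> site \<Rightarrow> bool) \<Rightarrow> site set \<Rightarrow> site set \<Rightarrow> bool" where
  "maximal_connected R T C \<longleftrightarrow>
     C \<subseteq> T \<and> connected_wrt R C \<and>
     (\<forall>D. C \<subseteq> D \<longrightarrow> D \<subseteq> T \<longrightarrow> connected_wrt R D \<longrightarrow> D = C)"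

definition zero_cluster :: "config \<Rightarrow> site set \<Rightarrow> bool" where
  "zero_cluster \<sigma> C \<longleftrightarrow> maximal_connected adjacent (\<sigma> -` {False}) C"

definition one_star_cluster :: "config \<Rightarrow> site set \<Rightarrow> bool" where
  "one_star_cluster \<sigma> C \<longleftrightarrow> maximal_connected star_adjacent (\<sigma> -` {True}) C"

definition coexistence :: "config set" where
  "coexistence =
     {\<sigma>. (\<exists>C. one_star_cluster \<sigma> C \<and> infinite C) \<and> (\<exists>C. zero_cluster \<sigma> C \<and> infinite C)}"

definition translate :: "site \<Rightarrow> config \<Rightarrow> config" where
  "translate a \<sigma> = (\<lambda>x. \<sigma> (x + a))"

definition translation_invariant :: "config measure \<Rightarrow> bool" where
  "translation_invariant \<rho> \<longleftrightarrow> (\<forall>a. distr \<rho> config_space (translate a) = \<rho>)"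

definition ergodic :: "config measure \<Rightarrow> bool" where
  "ergodic \<rho> \<longleftrightarrow>
     translation_invariant \<rho> \<and>
     (\<forall>A \<in> sets config_space.
        (\<forall>a. translate a -` A = A) \<longrightarrow> measure \<rho> A = 0 \<or> measure \<rho> A = 1)"

definition increasing :: "config set \<Rightarrow> bool" where
  "increasing A \<longleftrightarrow> (\<forall>\<xi> \<eta>. \<xi> \<in> A \<longrightarrow> \<xi> \<le> \<eta> \<longrightarrow> \<eta> \<in> A)"

definition positively_associated :: "config measure \<Rightarrow> bool" where
  "positively_associated \<rho> \<longleftrightarrow>
     (\<forall>A \<in> sets config_space. \<forall>B \<in> sets config_space.
        increasing A \<longrightarrow> increasing B \<longrightarrow> measure \<rho> A * measure \<rho> B \<le> measure \<rho> (A \<inter> B))"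

definition off_algebra :: "site set \<Rightarrow> config measure" where
  "off_algebra \<Delta> =
     vimage_algebra UNIV (\<lambda>\<sigma>. restrict \<sigma> (- \<Delta>)) (\<Pi>\<^sub>M x\<in>- \<Delta>. count_space UNIV)"

definition agree_on :: "site set \<Rightarrow> config \<Rightarrow> config set" where
  "agree_on \<Delta> \<eta> = {\<sigma>. \<forall>x\<in>\<Delta>. \<sigma> x = \<eta> x}"

text \<open>The conditional probability of an event given the configuration off \<open>\<Delta>\<close> is the conditional
  expectation of its indicator given \<open>off_algebra \<Delta>\<close>. Both the event \<open>agree_on \<Delta> \<eta>\<close> and
  the conditional expectation depend only on \<open>\<eta>\<close> on \<open>\<Delta>\<close> and on \<open>\<xi>\<close> off \<open>\<Delta>\<close>, so total
  configurations may be used for both.\<close>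

definition finite_energy :: "config measure \<Rightarrow> bool" where
  "finite_energy \<rho> \<longleftrightarrow>
     (\<forall>\<Delta>. finite \<Delta> \<longrightarrow>
        (\<forall>\<eta>. AE \<xi> in \<rho>. real_cond_exp \<rho> (off_algebra \<Delta>) (indicator (agree_on \<Delta> \<eta>)) \<xi> > 0))"

text \<open>The junk values of \<^const>\<open>real_cond_exp\<close> outside its domain do not occur above.\<close>

lemma subalgebra_off_algebra:
  assumes "sets \<rho> = sets config_space"
  shows "subalgebra \<rho> (off_algebra \<Delta>)"
proof -
  have sp: "space \<rho> = UNIV"
    using sets_eq_imp_space_eq[OF assms] by (simp add: config_space_def space_PiM)
  have "(\<lambda>\<sigma>. restrict \<sigma> (- \<Delta>)) \<in> measurable \<rho> (\<Pi>\<^sub>M x\<in>- \<Delta>. count_space (UNIV :: bool set))"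
    unfolding measurable_cong_sets[OF assms refl] config_space_def
    by (rule measurable_restrict_subset) simp
  then show ?thesis
    by (auto simp: subalgebra_def off_algebra_def sp sets_vimage_algebra2 space_PiM
        dest: measurable_sets)
qed

lemma agree_on_sets [measurable]:
  assumes "finite \<Delta>"
  shows "agree_on \<Delta> \<eta> \<in> sets config_space"
proof -
  have sp: "space config_space = UNIV"
    by (simp add: config_space_def space_PiM)
  have [measurable]: "(\<lambda>\<sigma>. \<sigma> x) \<in> measurable config_space (count_space UNIV)" for x
    unfolding config_space_def by measurable
  have "{\<sigma> \<in> space config_space. \<forall>x\<in>\<Delta>. \<sigma> x = \<eta> x} \<in> sets config_space"
    using assms by (intro sets.sets_Collect_finite_All) measurable
  then show ?thesis
    by (simp add: agree_on_def sp)
qed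

end

(*
  By ergodicity one may assume that both infinite clusters exist almost surely. The Burton-Keane
  argument makes each of them unique, so that inside a large square whp any two long arms of the
  same type are joined.

  Consider the strip 0 <= y <= h for large h. The strip is almost surely blocked to the left and to
  the right, hence an infinite cluster leaves it through its two sides, and by the square root trick
  a large square in the strip is whp connected to the upper side or whp connected to the lower side.
  Moving the square vertically, either some square in the middle is whp connected to both sides, or
  a square close to one side is whp connected to the opposite side. A second use of the square root
  trick splits a side at a point such that the square is connected to both halves. For each of the
  two types this yields a crossing of the strip that forks at one of the sides, around a point that
  can be moved horizontally by translation; unless it forks at both sides, it also ends in a bounded
  window of the other side. So either both types fork at the same side, or one type forks around the
  window in which the other one ends. Both are impossible for disjoint crossings in the plane.
*)

theory Submission
  imports Defs
begin

section \<open>Connected sets of sites\<close>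

text \<open>The measure has no reflection or rotation symmetry, so the four sides of a large square
  cannot be treated as equally easy to reach. A strip has only two sides, and the square root trick
  then says that one of them is likely to be reached, without telling which; this explains the
  alternatives and the vertical shift. Nor is \<rho> assumed ergodic under horizontal shifts alone.
  Blocking of the strip therefore comes from finite energy and from the fact that a column singled
  out in a stationary way cannot exist.

  The order of the choices matters. The window \<open>L\<close> in which a type ends depends on the
  gap \<open>T\<close> of its fork. So the ones are treated first, with \<open>T = 0\<close>; the
  zeros then receive a fork with gap \<open>L + 1\<close>, and only afterwards is the height
  \<open>h\<close> chosen. For this \<open>L\<close> must not depend on \<open>h\<close>. For the
  zeros a fork alone suffices, which avoids a circular choice.

  Both types share one locale. The difference between adjacency and star adjacency matters only for
  planarity: an axis-parallel edge and a diagonal edge can meet only if they share an endpoint,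
  whereas two diagonals can cross.\<close>

lemma site_dist_eq_sqrt:
  "site_dist x y = sqrt (real_of_int ((fst x - fst y)\<^sup>2 + (snd x - snd y)\<^sup>2))"
  by (simp add: site_dist_def dist_prod_def dist_real_def)

lemma adjacent_iff: "adjacent x y \<longleftrightarrow> \<bar>fst x - fst y\<bar> + \<bar>snd x - snd y\<bar> = 1"
proof -
  have *: "a\<^sup>2 + b\<^sup>2 = 1 \<longleftrightarrow> \<bar>a\<bar> + \<bar>b\<bar> = 1" for a b :: int
  proof
    assume h: "a\<^sup>2 + b\<^sup>2 = 1"
    have "\<bar>a\<bar> \<le> a\<^sup>2" "\<bar>b\<bar> \<le> b\<^sup>2"
      by (metis abs_le_square_iff abs_zero power2_abs self_le_power zero_less_numeral abs_ge_zero linorder_not_less mult_eq_0_iff nat_less_le order_le_less power2_eq_square zless_imp_add1_zle add_0)+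
    moreover have "(\<bar>a\<bar> + \<bar>b\<bar>) \<noteq> 0"
    proof
      assume "\<bar>a\<bar> + \<bar>b\<bar> = 0"
      then have "a = 0" "b = 0" by linarith+
      then show False using h by simp
    qed
    ultimately show "\<bar>a\<bar> + \<bar>b\<bar> = 1" using h by linarith
  next
    assume h: "\<bar>a\<bar> + \<bar>b\<bar> = 1"
    then have "(a = 0 \<and> \<bar>b\<bar> = 1) \<or> (\<bar>a\<bar> = 1 \<and> b = 0)" by arith
    then show "a\<^sup>2 + b\<^sup>2 = 1" by (auto simp: power2_eq_1_iff abs_eq_iff')
  qed
  have "adjacent x y \<longleftrightarrow> (fst x - fst y)\<^sup>2 + (snd x - snd y)\<^sup>2 = 1"
    unfolding adjacent_def site_dist_eq_sqrt real_sqrt_eq_1_iff by linarith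
  then show ?thesis by (simp add: *)
qed

lemma star_adjacent_iff:
  "star_adjacent x y \<longleftrightarrow> x \<noteq> y \<and> \<bar>fst x - fst y\<bar> \<le> 1 \<and> \<bar>snd x - snd y\<bar> \<le> 1"
proof -
  have *: "a\<^sup>2 + b\<^sup>2 = 1 \<or> a\<^sup>2 + b\<^sup>2 = 2 \<longleftrightarrow> \<not> (a = 0 \<and> b = 0) \<and> \<bar>a\<bar> \<le> 1 \<and> \<bar>b\<bar> \<le> 1" for a b :: int
  proof
    assume h: "a\<^sup>2 + b\<^sup>2 = 1 \<or> a\<^sup>2 + b\<^sup>2 = 2"
    have "\<bar>c\<bar> \<le> 1" if "c\<^sup>2 \<le> 2" for c :: int
    proof (rule ccontr)
      assume "\<not> \<bar>c\<bar> \<le> 1"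
      then have "2\<^sup>2 \<le> \<bar>c\<bar>\<^sup>2" by (intro power_mono) auto
      then show False using that by simp
    qed
    moreover have "a\<^sup>2 \<le> 2" "b\<^sup>2 \<le> 2"
      using h zero_le_power2[of a] zero_le_power2[of b] by linarith+
    ultimately show "\<not> (a = 0 \<and> b = 0) \<and> \<bar>a\<bar> \<le> 1 \<and> \<bar>b\<bar> \<le> 1" using h by auto
  next
    assume h: "\<not> (a = 0 \<and> b = 0) \<and> \<bar>a\<bar> \<le> 1 \<and> \<bar>b\<bar> \<le> 1"
    then have "a \<in> {-1, 0, 1}" "b \<in> {-1, 0, 1}" by auto
    then show "a\<^sup>2 + b\<^sup>2 = 1 \<or> a\<^sup>2 + b\<^sup>2 = 2" using h by auto
  qed
  have "star_adjacent x y \<longleftrightarrow>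
      (fst x - fst y)\<^sup>2 + (snd x - snd y)\<^sup>2 = 1 \<or> (fst x - fst y)\<^sup>2 + (snd x - snd y)\<^sup>2 = 2"
    unfolding star_adjacent_def site_dist_eq_sqrt real_sqrt_eq_1_iff real_sqrt_eq_iff by linarith
  then show ?thesis unfolding * by (auto simp: prod_eq_iff)
qed

lemma adjacent_imp_star_adjacent: "adjacent x y \<Longrightarrow> star_adjacent x y"
  by (auto simp: adjacent_def star_adjacent_def)

text \<open>The conjunct \<open>x \<in> S\<close> makes the relation empty outside \<open>S\<close>,
  where the reflexive closure alone would still relate a site to itself.\<close>

definition con :: "(site \<Rightarrow> site \<Rightarrow> bool) \<Rightarrow> site set \<Rightarrow> site \<Rightarrow> site \<Rightarrow> bool" where
  "con R S x y \<longleftrightarrow> x \<in> S \<and> (\<lambda>u v. u \<in> S \<and> v \<in> S \<and> R u v)\<^sup>*\<^sup>* x y"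

lemma con_refl: "x \<in> S \<Longrightarrow> con R S x x"
  by (simp add: con_def)

lemma con_in1: "con R S x y \<Longrightarrow> x \<in> S"
  by (simp add: con_def)

lemma con_in2: "con R S x y \<Longrightarrow> y \<in> S"
  unfolding con_def by (auto elim: rtranclp.cases)

lemma con_step: "x \<in> S \<Longrightarrow> y \<in> S \<Longrightarrow> R x y \<Longrightarrow> con R S x y"
  by (auto simp: con_def)

lemma con_trans [trans]: "con R S x y \<Longrightarrow> con R S y z \<Longrightarrow> con R S x z"
  by (auto simp: con_def)

lemma con_mono: "con R S x y \<Longrightarrow> S \<subseteq> S' \<Longrightarrow> con R S' x y"
  unfolding con_def by (auto elim!: rtranclp_mono[THEN predicate2D, rotated])

lemma con_mono_rel: "con R S x y \<Longrightarrow> (\<And>u v. R u v \<Longrightarrow> R' u v) \<Longrightarrow> con R' S x y"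
  unfolding con_def by (auto elim!: rtranclp_mono[THEN predicate2D, rotated])

lemma con_induct [consumes 1, case_names refl step]:
  assumes "con R S x y" and "x \<in> S \<Longrightarrow> P x"
    and "\<And>u w. con R S x u \<Longrightarrow> w \<in> S \<Longrightarrow> R u w \<Longrightarrow> P u \<Longrightarrow> P w"
  shows "P y"
proof -
  have "(\<lambda>u v. u \<in> S \<and> v \<in> S \<and> R u v)\<^sup>*\<^sup>* x y" "x \<in> S" using assms(1) by (auto simp: con_def)
  then show ?thesis
  proof (induction rule: rtranclp_induct)
    case base then show ?case using assms(2) by simp
  next
    case (step u w) then show ?case using assms(3)[of u w] by (auto simp: con_def)
  qed
qed

lemma con_sym:
  assumes "symp R" and "con R S x y" shows "con R S y x"
  using assms(2)
proof (induction rule: con_induct)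
  case refl then show ?case by (rule con_refl)
next
  case (step u w)
  then have "con R S w u" using assms(1) by (intro con_step) (auto dest: con_in2 sympD)
  then show ?case using step con_trans by blast
qed

text \<open>Stop at the first step that leaves \<open>D\<close>; up to there the path runs inside
  \<open>D\<close>.\<close>

lemma con_exit:
  assumes "con R S x y" and "x \<in> D"
  shows "con R (S \<inter> D) x y \<or> (\<exists>w w'. con R (S \<inter> D) x w \<and> w' \<in> S - D \<and> R w w')"
  using assms
proof (induction rule: con_induct)
  case refl then show ?case by (auto intro: con_refl)
next
  case (step u w)
  then consider "con R (S \<inter> D) x u" | "\<exists>w w'. con R (S \<inter> D) x w \<and> w' \<in> S - D \<and> R w w'" by blast
  then show ?case
  proof cases
    case 1
    show ?thesis
    proof (cases "w \<in> D")
      case True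
      then have "con R (S \<inter> D) u w" using step con_in2[OF 1] by (intro con_step) auto
      then show ?thesis using con_trans[OF 1] by blast
    next
      case False then show ?thesis using step 1 by blast
    qed
  next
    case 2 then show ?thesis by blast
  qed
qed

lemma con_exitE:
  assumes "con R S x y" "x \<in> D" "\<not> con R (S \<inter> D) x y"
  obtains w w' where "con R (S \<inter> D) x w" "w' \<in> S - D" "R w w'"
  using con_exit[OF assms(1,2)] assms(3) by blast

lemma con_last_exit:
  assumes "con R S x y" and "y \<notin> D" and "x \<in> D"
  shows "\<exists>u w. con R S x u \<and> u \<in> D \<and> R u w \<and> con R (S - D) w y"
  using assms
proof (induction rule: con_induct)
  case refl then show ?case by auto
next
  case (step u w)
  show ?case
  proof (cases "u \<in> D")
    case True
    then show ?thesis using step by (intro exI[of _ u] exI[of _ w]) (auto intro: con_refl)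
  next
    case False
    then obtain a b where ab: "con R S x a" "a \<in> D" "R a b" "con R (S - D) b u" using step by blast
    have "con R (S - D) u w" using step ab con_in2[OF ab(4)] by (intro con_step) auto
    then show ?thesis using ab con_trans by blast
  qed
qed

lemma con_finite:
  assumes "con R S x y"
  shows "\<exists>F. finite F \<and> F \<subseteq> S \<and> con R F x y"
  using assms
proof (induction rule: con_induct)
  case refl then show ?case by (intro exI[of _ "{x}"]) (auto intro: con_refl)
next
  case (step u w)
  then obtain F where F: "finite F" "F \<subseteq> S" "con R F x u" by blast
  have "con R (insert w F) u w" using step con_in2[OF F(3)] by (intro con_step) auto
  then have "con R (insert w F) x w" using con_trans con_mono[OF F(3)] by blast
  then show ?case using F step by (intro exI[of _ "insert w F"]) auto
qed

lemma con_finite_iff: "con R S x y \<longleftrightarrow> (\<exists>F. finite F \<and> F \<subseteq> S \<and> con R F x y)"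
  using con_finite con_mono by metis

lemma con_shift:
  assumes "\<And>x y. R (x + a) (y + a) = R x y"
  shows "con R {x. x + a \<in> S} x y \<longleftrightarrow> con R S (x + a) (y + a)"
proof
  assume "con R {x. x + a \<in> S} x y"
  then show "con R S (x + a) (y + a)"
  proof (induction rule: con_induct)
    case refl then show ?case by (auto intro: con_refl)
  next
    case (step u w)
    then show ?case using assms con_in2[OF step(1)] con_trans[OF _ con_step[of "u+a" S "w+a" R]] by blast
  qed
next
  assume *: "con R S (x + a) (y + a)"
  have "con R {x. x + a \<in> S} x (z - a)" if "con R S (x + a) z" for z
    using that
  proof (induction rule: con_induct)
    case refl then show ?case by (auto intro: con_refl)
  next
    case (step u w)
    have "con R {x. x + a \<in> S} (u - a) (w - a)"
      using step con_in2[OF step(1)] assms[of "u - a" "w - a"] by (intro con_step) auto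
    then show ?case using step con_trans by blast
  qed
  from this[OF *] show "con R {x. x + a \<in> S} x y" by simp
qed

lemma con_row:
  assumes "\<And>x. x1 \<le> x \<Longrightarrow> x \<le> x2 \<Longrightarrow> (x, r) \<in> S" and "x1 \<le> x2"
  shows "con adjacent S (x1, r) (x2, r)"
  using assms(2,1)
proof (induction x2 rule: int_ge_induct)
  case base then show ?case by (intro con_refl) auto
next
  case (step i)
  have "con adjacent S (i, r) (i + 1, r)" using step by (intro con_step) (auto simp: adjacent_iff)
  then show ?case using step con_trans[of adjacent S "(x1, r)" "(i, r)"] by auto
qed

lemma con_column:
  assumes "\<And>y. y1 \<le> y \<Longrightarrow> y \<le> y2 \<Longrightarrow> (c, y) \<in> S" and "y1 \<le> y2"
  shows "con adjacent S (c, y1) (c, y2)"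
  using assms(2,1)
proof (induction y2 rule: int_ge_induct)
  case base then show ?case by (intro con_refl) auto
next
  case (step i)
  have "con adjacent S (c, i) (c, i + 1)" using step by (intro con_step) (auto simp: adjacent_iff)
  then show ?case using step con_trans[of adjacent S "(c, y1)" "(c, i)"] by auto
qed

lemma symp_adjacent: "symp adjacent" and symp_star_adjacent: "symp star_adjacent"
  by (auto simp: symp_def adjacent_iff star_adjacent_iff)

section \<open>Squares as an exhaustion of the lattice\<close>

definition square :: "site \<Rightarrow> int \<Rightarrow> site set" where
  "square c k = {z. \<bar>fst z - fst c\<bar> \<le> k \<and> \<bar>snd z - snd c\<bar> \<le> k}"

lemma square_eq: "square c k = {fst c - k..fst c + k} \<times> {snd c - k..snd c + k}"
  by (auto simp: square_def)

lemma finite_square [simp]: "finite (square c k)"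
  by (simp add: square_eq)

lemma finite_subset_square:
  assumes "finite F" shows "\<exists>n::nat. F \<subseteq> square c (int n)"
proof -
  let ?m = "\<lambda>z. \<bar>fst z - fst c\<bar> + \<bar>snd z - snd c\<bar>"
  obtain m where m: "\<And>z. z \<in> F \<Longrightarrow> ?m z \<le> m"
    using finite_imageI[OF assms, of ?m] by (metis (no_types, lifting) Max_ge image_eqI)
  have "F \<subseteq> square c (int (nat m))"
  proof
    fix z assume "z \<in> F"
    from m[OF this] show "z \<in> square c (int (nat m))" by (auto simp: square_def)
  qed
  then show ?thesis ..
qed

text \<open>Expresses infinitude by countable quantifiers over sites and radii, from which
  \<open>infinite_con_measurable\<close> follows.\<close>

lemma infinite_iff_unbounded:
  "infinite (A :: site set) \<longleftrightarrow> (\<forall>n::nat. \<exists>y. y \<in> A \<and> y \<notin> square c (int n))"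
proof
  assume "infinite A"
  then show "\<forall>n::nat. \<exists>y. y \<in> A \<and> y \<notin> square c (int n)"
    using finite_subset[OF _ finite_square] by blast
next
  assume *: "\<forall>n::nat. \<exists>y. y \<in> A \<and> y \<notin> square c (int n)"
  show "infinite A"
  proof
    assume "finite A"
    then show False using finite_subset_square[of A c] * by blast
  qed
qed

lemma con_square:
  assumes "x \<in> square c k" "y \<in> square c k" "square c k \<subseteq> S"
  shows "con adjacent S x y"
proof -
  have row: "con adjacent S (a, r) (b, r)" if "(a, r) \<in> square c k" "(b, r) \<in> square c k" "a \<le> b" for a b r
    using that assms(3) by (intro con_row) (auto simp: square_def subset_iff)
  have col: "con adjacent S (r, a) (r, b)" if "(r, a) \<in> square c k" "(r, b) \<in> square c k" "a \<le> b" for a b r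
    using that assms(3) by (intro con_column) (auto simp: square_def subset_iff)
  obtain x1 x2 y1 y2 where xy: "x = (x1, x2)" "y = (y1, y2)" by (cases x, cases y)
  have in3: "(y1, x2) \<in> square c k" using assms xy by (auto simp: square_def)
  have "con adjacent S (x1, x2) (y1, x2)"
    using row[of x1 x2 y1] row[of y1 x2 x1] con_sym[OF symp_adjacent] assms xy in3
    by (cases "x1 \<le> y1") auto
  also have "con adjacent S (y1, x2) (y1, y2)"
    using col[of y1 x2 y2] col[of y1 y2 x2] con_sym[OF symp_adjacent] assms xy in3
    by (cases "x2 \<le> y2") auto
  finally show ?thesis using xy by simp
qed

lemma card_square: "0 \<le> k \<Longrightarrow> real (card (square c k)) = (2 * real_of_int k + 1)\<^sup>2"
  by (simp add: square_eq card_cartesian_product power2_eq_square)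

lemma square_mono: "k \<le> l \<Longrightarrow> square c k \<subseteq> square c l"
  by (auto simp: square_def)

lemma square_subset:
  "\<bar>fst c - fst d\<bar> + k \<le> l \<Longrightarrow> \<bar>snd c - snd d\<bar> + k \<le> l \<Longrightarrow> square c k \<subseteq> square d l"
  by (auto simp: square_def)

lemma square_translate: "{z. z + a \<in> square (c + a) k} = square c k" "x + a \<in> square (c + a) k \<longleftrightarrow> x \<in> square c k"
  by (auto simp: square_def)

lemma all_ex_translate:
  fixes a :: site
  shows "(\<forall>x. P (x + a)) \<longleftrightarrow> (\<forall>x. P x)" "(\<exists>x. P (x + a)) \<longleftrightarrow> (\<exists>x. P x)"
  by (metis diff_add_cancel)+

section \<open>Crossings of a strip\<close>

definition point :: "site \<Rightarrow> real ^ 2" where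
  "point x = vector [real_of_int (fst x), real_of_int (snd x)]"

lemma point_nth [simp]: "point x $ 1 = real_of_int (fst x)" "point x $ 2 = real_of_int (snd x)"
  by (simp_all add: point_def)

lemma con_imp_path:
  assumes "con R S x y"
  shows "\<exists>g. path g \<and> pathstart g = point x \<and> pathfinish g = point y \<and>
    path_image g \<subseteq> (\<Union>u\<in>S. \<Union>w\<in>{w\<in>S. R u w \<or> u = w}. closed_segment (point u) (point w))"
    (is "\<exists>g. ?P g y")
  using assms
proof (induction rule: con_induct)
  case refl
  then have "point x \<in> (\<Union>u\<in>S. \<Union>w\<in>{w\<in>S. R u w \<or> u = w}. closed_segment (point u) (point w))"
    by (intro UN_I[of x]) auto
  \<comment> \<open>The union admits \<open>u = w\<close> for the sake of this constant
    path.\<close>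
  then have "?P (linepath (point x) (point x)) x"
    by (metis (no_types, lifting) closed_segment_idem empty_subsetI insert_subset path_image_linepath
        path_linepath pathfinish_linepath pathstart_linepath)
  then show ?case by blast
next
  case (step u w)
  then obtain g where g: "?P g u" by blast
  have "u \<in> S" using step(1) by (rule con_in2)
  then have "?P (g +++ linepath (point u) (point w)) w"
    using g step(2,3) by (auto simp: path_image_join)
  then show ?case by blast
qed

lemma unit_interval_int:
  assumes "real_of_int m = t" "0 \<le> t" "t \<le> 1" shows "t = 0 \<or> t = 1"
  using assms by (metis of_int_0 of_int_1 of_int_le_iff order_antisym int_one_le_iff_zero_less not_less)

text \<open>The first segment has ends \<open>(a, b)\<close> and \<open>(a + e, b)\<close>, the
  second joins \<open>(p, q)\<close> to \<open>(p', q')\<close>; a common point forces a common end.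
  If \<open>q' \<noteq> q\<close>, integrality of \<open>b\<close> puts the common point at an end
  of the second segment, hence at a lattice point, hence at an end of the first. If
  \<open>q' = q\<close>, both are intervals of length at most one on the same line.\<close>

lemma meet_aux:
  fixes a b p q p' q' e :: int and s t :: real
  assumes "0 \<le> s" "s \<le> 1" "0 \<le> t" "t \<le> 1" "\<bar>e\<bar> \<le> 1" "\<bar>p' - p\<bar> \<le> 1" "\<bar>q' - q\<bar> \<le> 1"
    and 1: "a + s * e = p + t * (p' - p)" and 2: "b = q + t * (q' - q)"
  shows "(b = q \<or> b = q') \<and> ((b = q \<and> a = p) \<or> (b = q \<and> a + e = p) \<or> (b = q' \<and> a = p') \<or> (b = q' \<and> a + e = p'))"
proof -
  have e: "e = -1 \<or> e = 0 \<or> e = 1" using assms(5) by arith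
  have dp: "p' - p = -1 \<or> p' - p = 0 \<or> p' - p = 1" using assms(6) by arith
  have ends: "c = a \<or> c = a + e" if "real_of_int c = a + s * e" for c
  proof -
    have "s * e = real_of_int (c - a)" using that by simp
    then show ?thesis using e unit_interval_int[of "c - a" s] unit_interval_int[of "a - c" s] assms(1,2) by fastforce
  qed
  show ?thesis
  proof (cases "q' = q")
    case True
    then have b: "b = q" "b = q'" using 2 by auto
    show ?thesis
    proof (cases "p' = p")
      case True then show ?thesis using ends[of p] 1 b by auto
    next
      case False
      have "a = p \<or> a + e = p \<or> a = p' \<or> a + e = p'"
      proof (rule ccontr)
        assume n: "\<not> ?thesis"
        have d: "p' = p + 1 \<or> p' = p - 1" using dp False by auto
        have lo: "min p p' \<le> p + t * (p' - p)" "p + t * (p' - p) \<le> max p p'"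
          using d assms(3,4) by (auto simp: min_def max_def)
        have lo2: "min a (a + e) \<le> a + s * e" "a + s * e \<le> max a (a + e)"
          using e assms(1,2) by (auto simp: min_def max_def)
        have "real_of_int (min p p') \<le> real_of_int (max a (a + e))" using lo(1) lo2(2) 1 by linarith
        moreover have "real_of_int (min a (a + e)) \<le> real_of_int (max p p')" using lo(2) lo2(1) 1 by linarith
        ultimately have "min p p' \<le> max a (a + e)" "min a (a + e) \<le> max p p'" by linarith+
        then show False using n d e by (auto simp: min_def max_def split: if_splits)
      qed
      then show ?thesis using b by auto
    qed
  next
    case False
    then have "q' = q + 1 \<or> q' = q - 1" using assms(7) by arith
    then have "t = real_of_int (b - q) \<or> t = real_of_int (q - b)" using 2 by auto
    then have "t = 0 \<or> t = 1" using unit_interval_int assms(3,4) by metis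
    then show ?thesis using 1 2 ends[of p] ends[of p'] by fastforce
  qed
qed

text \<open>One edge must be axis-parallel, since the two diagonals of a unit square cross at its
  centre without sharing a site. Exchanging the coordinates reduces a vertical edge to
  \<open>meet_aux\<close>.\<close>

lemma segments_meet:
  assumes "adjacent u w \<or> u = w" "star_adjacent u' w' \<or> u' = w'"
    and "z \<in> closed_segment (point u) (point w)" "z \<in> closed_segment (point u') (point w')"
  shows "{u, w} \<inter> {u', w'} \<noteq> {}"
proof -
  obtain s where s: "0 \<le> s" "s \<le> 1" "z = (1 - s) *\<^sub>R point u + s *\<^sub>R point w"
    using assms(3) by (auto simp: in_segment)
  obtain t where t: "0 \<le> t" "t \<le> 1" "z = (1 - t) *\<^sub>R point u' + t *\<^sub>R point w'"
    using assms(4) by (auto simp: in_segment)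
  have z: "z $ 1 = fst u + s * (fst w - fst u)" "z $ 2 = snd u + s * (snd w - snd u)"
    "z $ 1 = fst u' + t * (fst w' - fst u')" "z $ 2 = snd u' + t * (snd w' - snd u')"
    subgoal unfolding s(3) by (simp add: algebra_simps)
    subgoal unfolding s(3) by (simp add: algebra_simps)
    subgoal unfolding t(3) by (simp add: algebra_simps)
    subgoal unfolding t(3) by (simp add: algebra_simps)
    done
  have d: "\<bar>fst w' - fst u'\<bar> \<le> 1" "\<bar>snd w' - snd u'\<bar> \<le> 1"
    using assms(2) by (auto simp: star_adjacent_iff)
  have "(snd w = snd u \<and> \<bar>fst w - fst u\<bar> \<le> 1) \<or> (fst w = fst u \<and> \<bar>snd w - snd u\<bar> \<le> 1)"
    using assms(1) by (auto simp: adjacent_iff abs_if split: if_splits)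
  then show ?thesis
  proof (elim disjE conjE)
    assume a: "snd w = snd u" "\<bar>fst w - fst u\<bar> \<le> 1"
    have "fst u + s * real_of_int (fst w - fst u) = fst u' + t * (fst w' - fst u')"
      "real_of_int (snd u) = snd u' + t * (snd w' - snd u')" using z a(1) by simp_all
    from meet_aux[OF s(1,2) t(1,2) a(2) d this] show ?thesis
      using a(1) by (cases u; cases w; cases u'; cases w') auto
  next
    assume a: "fst w = fst u" "\<bar>snd w - snd u\<bar> \<le> 1"
    have "snd u + s * real_of_int (snd w - snd u) = snd u' + t * (snd w' - snd u')"
      "real_of_int (fst u) = fst u' + t * (fst w' - fst u')" using z a(1) by simp_all
    from meet_aux[OF s(1,2) t(1,2) a(2) d(2,1) this] show ?thesis
      using a(1) by (cases u; cases w; cases u'; cases w') auto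
  qed
qed

text \<open>The sites are joined by segments, so that the \<open>fashoda\<close> theorem on crossing
  curves in a rectangle applies; \<open>segments_meet\<close> turns the common point into a common
  site.\<close>

lemma rectangle_crossing:
  assumes Z: "con adjacent Z x x'" and W: "con star_adjacent W y y'"
    and "Z \<union> W \<subseteq> {x1..x2} \<times> {y1..y2}"
    and "fst x = x1" "fst x' = x2" "snd y = y1" "snd y' = y2"
  shows "Z \<inter> W \<noteq> {}"
proof -
  obtain f where f: "path f" "pathstart f = point x" "pathfinish f = point x'"
    "path_image f \<subseteq> (\<Union>u\<in>Z. \<Union>w\<in>{w\<in>Z. adjacent u w \<or> u = w}. closed_segment (point u) (point w))"
    using con_imp_path[OF Z] by blast
  obtain g where g: "path g" "pathstart g = point y" "pathfinish g = point y'"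
    "path_image g \<subseteq> (\<Union>u\<in>W. \<Union>w\<in>{w\<in>W. star_adjacent u w \<or> u = w}. closed_segment (point u) (point w))"
    using con_imp_path[OF W] by blast
  let ?c = "cbox (point (x1, y1)) (point (x2, y2))"
  have pt: "point u \<in> ?c" if "u \<in> Z \<union> W" for u
    using that assms(3) by (force simp: mem_box_cart forall_2)
  have seg: "closed_segment (point u) (point w) \<subseteq> ?c" if "u \<in> Z \<union> W" "w \<in> Z \<union> W" for u w
    using pt[OF that(1)] pt[OF that(2)] by (intro closed_segment_subset convex_box)
  have "path_image f \<subseteq> ?c" "path_image g \<subseteq> ?c"
    using f(4) g(4) seg by blast+
  then obtain z where "z \<in> path_image f" "z \<in> path_image g"
    using fashoda[OF f(1) g(1), of "point (x1, y1)" "point (x2, y2)"] f(2,3) g(2,3) assms(4-7)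
    by auto
  then obtain u w u' w' where "u \<in> Z" "w \<in> Z" "adjacent u w \<or> u = w" "z \<in> closed_segment (point u) (point w)"
    "u' \<in> W" "w' \<in> W" "star_adjacent u' w' \<or> u' = w'" "z \<in> closed_segment (point u') (point w')"
    using f(4) g(4) by blast
  then show ?thesis using segments_meet[of u w u' w' z] by blast
qed

section \<open>Order of disjoint crossings of a strip\<close>

definition strip :: "int \<Rightarrow> site set" where
  "strip h = {z. 0 \<le> snd z \<and> snd z \<le> h}"

text \<open>A change of order is refuted by extending one crossing to the left and right borders of
  a rectangle and the other to its bottom and top, without creating new intersections.\<close>

lemma strip_crossing_aux:
  assumes Z: "con adjacent (Z \<inter> strip h) (a, 0) (a', h)"
    and W: "con star_adjacent (W \<inter> strip h) (c, 0) (c', h)"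
    and "Z \<inter> W = {}"
  shows "\<not> (a < c \<and> c' < a')" and "\<not> (c < a \<and> a' < c')"
proof -
  obtain F where F: "finite F" "F \<subseteq> Z \<inter> strip h" "con adjacent F (a, 0) (a', h)"
    using con_finite[OF Z] by blast
  obtain G where G: "finite G" "G \<subseteq> W \<inter> strip h" "con star_adjacent G (c, 0) (c', h)"
    using con_finite[OF W] by blast
  obtain N where N: "F \<union> G \<subseteq> square (0, 0) (int N)"
    using finite_subset_square[of "F \<union> G"] F G by blast
  have mem: "(a, 0) \<in> F" "(a', h) \<in> F" "(c, 0) \<in> G" "(c', h) \<in> G"
    using con_in1[OF F(3)] con_in2[OF F(3)] con_in1[OF G(3)] con_in2[OF G(3)] by auto
  then have bd: "\<bar>a\<bar> \<le> N" "\<bar>a'\<bar> \<le> N" "\<bar>c\<bar> \<le> N" "\<bar>c'\<bar> \<le> N" using N by (auto simp: square_def)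
  have h: "0 \<le> h" using mem F by (auto simp: strip_def)
  have FG: "F \<inter> G = {}" using F G assms(3) by blast
  have Fb: "- int N \<le> fst z \<and> fst z \<le> int N \<and> 0 \<le> snd z \<and> snd z \<le> h" if "z \<in> F \<union> G" for z :: site
  proof -
    have "z \<in> square (0, 0) (int N)" "z \<in> strip h" using that N F G by blast+
    then show ?thesis by (auto simp: square_def strip_def)
  qed
  have Fs: "F \<subseteq> {- int N..int N} \<times> {0..h}" and Gs: "G \<subseteq> {- int N..int N} \<times> {0..h}"
    unfolding subset_iff mem_Times_iff atLeastAtMost_iff using Fb by blast+
  have wide: "{- int N..int N} \<times> {0..h} \<subseteq> {- int N..int N} \<times> {-2..h + 2}" by auto
  have Fout: "(x, y) \<notin> F" "(x, y) \<notin> G" if "y < 0 \<or> y > h" for x y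
    using that Fs Gs by force+
  \<comment> \<open>Rows \<open>-1\<close> and \<open>h + 1\<close> carry the extensions of
    \<open>F\<close> to the sides. So \<open>G\<close> is continued past them to rows
    \<open>-2\<close> and \<open>h + 2\<close>, the bottom and top of the rectangle.\<close>
  let ?V = "G \<union> {(c, -1), (c, -2), (c', h + 1), (c', h + 2)}"
  have V: "con star_adjacent ?V (c, -2) (c', h + 2)"
  proof -
    have "con star_adjacent ?V (c, -2) (c, -1)" by (intro con_step) (auto simp: star_adjacent_iff)
    also have "con star_adjacent ?V (c, -1) (c, 0)"
      using mem by (intro con_step) (auto simp: star_adjacent_iff)
    also have "con star_adjacent ?V (c, 0) (c', h)" using G(3) by (rule con_mono) auto
    also have "con star_adjacent ?V (c', h) (c', h + 1)"
      using mem by (intro con_step) (auto simp: star_adjacent_iff)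
    also have "con star_adjacent ?V (c', h + 1) (c', h + 2)" by (intro con_step) (auto simp: star_adjacent_iff)
    finally show ?thesis .
  qed
  have Vb: "?V \<subseteq> {- int N..int N} \<times> {-2..h + 2}"
  proof (intro Un_least)
    show "G \<subseteq> {- int N..int N} \<times> {-2..h + 2}" using order_trans[OF Gs wide] .
    show "{(c, -1), (c, -2), (c', h + 1), (c', h + 2)} \<subseteq> {- int N..int N} \<times> {-2..h + 2}"
      using bd h by auto
  qed
  show "\<not> (a < c \<and> c' < a')"
  proof
    assume lt: "a < c \<and> c' < a'"
    \<comment> \<open>\<open>F\<close> is continued to the left below the strip and to the right
      above it; by \<open>a < c\<close> and \<open>c' < a'\<close> these rows avoid the columns of
      \<open>c\<close> and \<open>c'\<close>.\<close>
    let ?U = "F \<union> {- int N..a} \<times> {-1} \<union> {a'..int N} \<times> {h + 1}"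
    have "con adjacent ?U (- int N, -1) (a, -1)" using bd by (intro con_row) auto
    also have "con adjacent ?U (a, -1) (a, 0)" using mem bd by (intro con_step) (auto simp: adjacent_iff)
    also have "con adjacent ?U (a, 0) (a', h)" using F(3) by (rule con_mono) auto
    also have "con adjacent ?U (a', h) (a', h + 1)" using mem bd by (intro con_step) (auto simp: adjacent_iff)
    also have "con adjacent ?U (a', h + 1) (int N, h + 1)" using bd by (intro con_row) auto
    finally have U: "con adjacent ?U (- int N, -1) (int N, h + 1)" .
    have Ub: "?U \<subseteq> {- int N..int N} \<times> {-2..h + 2}"
      using order_trans[OF Fs wide] by (intro Un_least Sigma_mono) (use bd h in \<open>auto simp del: Times_subset_cancel2\<close>)
    have "?U \<inter> ?V \<noteq> {}"
      by (rule rectangle_crossing[OF U V]) (use Ub Vb in auto)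
    moreover have "?U \<inter> ?V = {}"
      unfolding Int_Un_distrib Int_Un_distrib2 Un_empty using FG Fout lt h by auto
    ultimately show False by blast
  qed
  show "\<not> (c < a \<and> a' < c')"
  proof
    assume lt: "c < a \<and> a' < c'"
    \<comment> \<open>Mirror image: to the right below, to the left above. The path is reversed
      afterwards because \<open>rectangle_crossing\<close> starts at the left border.\<close>
    let ?U = "F \<union> {a..int N} \<times> {-1} \<union> {- int N..a'} \<times> {h + 1}"
    have "con adjacent ?U (a, -1) (int N, -1)" using bd by (intro con_row) auto
    then have r1: "con adjacent ?U (int N, -1) (a, -1)" by (rule con_sym[OF symp_adjacent])
    have "con adjacent ?U (- int N, h + 1) (a', h + 1)" using bd by (intro con_row) auto
    then have r2: "con adjacent ?U (a', h + 1) (- int N, h + 1)" by (rule con_sym[OF symp_adjacent])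
    note r1
    also have "con adjacent ?U (a, -1) (a, 0)" using mem bd by (intro con_step) (auto simp: adjacent_iff)
    also have "con adjacent ?U (a, 0) (a', h)" using F(3) by (rule con_mono) auto
    also have "con adjacent ?U (a', h) (a', h + 1)" using mem bd by (intro con_step) (auto simp: adjacent_iff)
    also note r2
    finally have "con adjacent ?U (int N, -1) (- int N, h + 1)" .
    then have U: "con adjacent ?U (- int N, h + 1) (int N, -1)" by (rule con_sym[OF symp_adjacent])
    have Ub: "?U \<subseteq> {- int N..int N} \<times> {-2..h + 2}"
      using order_trans[OF Fs wide] by (intro Un_least Sigma_mono) (use bd h in \<open>auto simp del: Times_subset_cancel2\<close>)
    have "?U \<inter> ?V \<noteq> {}"
      by (rule rectangle_crossing[OF U V]) (use Ub Vb in auto)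
    moreover have "?U \<inter> ?V = {}"
      unfolding Int_Un_distrib Int_Un_distrib2 Un_empty using FG Fout lt h by auto
    ultimately show False by blast
  qed
qed

lemma strip_crossing:
  assumes Z: "con adjacent (Z \<inter> strip h) (a, 0) (a', h)"
    and W: "con star_adjacent (W \<inter> strip h) (c, 0) (c', h)"
    and "Z \<inter> W = {}"
  shows "a < c \<longleftrightarrow> a' < c'"
proof -
  have "a \<noteq> c" using con_in1[OF Z] con_in1[OF W] assms(3) by auto
  moreover have "a' \<noteq> c'" using con_in2[OF Z] con_in2[OF W] assms(3) by auto
  ultimately show ?thesis using strip_crossing_aux[OF assms] by linarith
qed

section \<open>Translations, finite energy and positive association\<close>

lemma measurable_config:
  assumes "\<And>x. (\<lambda>\<omega>. f \<omega> x) \<in> measurable M (count_space (UNIV :: bool set))"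
  shows "f \<in> measurable M config_space"
  unfolding config_space_def by (rule measurable_PiM_single') (use assms in auto)

text \<open>Monotonicity in the set of sites with value \<open>v\<close>: increasing events for the
  ones, decreasing events for the zeros.\<close>

definition type_increasing :: "bool \<Rightarrow> config set \<Rightarrow> bool" where
  "type_increasing v A \<longleftrightarrow> (\<forall>\<xi> \<eta>. \<xi> \<in> A \<longrightarrow> \<xi> -` {v} \<subseteq> \<eta> -` {v} \<longrightarrow> \<eta> \<in> A)"

lemma type_increasing_True: "type_increasing True A \<longleftrightarrow> increasing A"
proof -
  have "\<xi> -` {True} \<subseteq> \<eta> -` {True} \<longleftrightarrow> \<xi> \<le> \<eta>" for \<xi> \<eta> :: config
    by (auto simp: le_fun_def)
  then show ?thesis by (simp only: type_increasing_def increasing_def)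
qed

lemma type_increasing_False: "type_increasing False A \<longleftrightarrow> increasing (- A)"
proof -
  have "\<xi> -` {False} \<subseteq> \<eta> -` {False} \<longleftrightarrow> \<eta> \<le> \<xi>" for \<xi> \<eta> :: config
    by (auto simp: le_fun_def)
  then show ?thesis by (auto simp only: type_increasing_def increasing_def Compl_iff)
qed

locale percolation = prob_space \<rho> for \<rho> :: "config measure" +
  assumes sets_rho: "sets \<rho> = sets config_space"
    and ergodic_rho: "ergodic \<rho>"
    and positively_associated_rho: "positively_associated \<rho>"
    and finite_energy_rho: "finite_energy \<rho>"
begin

lemma space_rho [simp]: "space \<rho> = UNIV"
  using sets_eq_imp_space_eq[OF sets_rho] by (simp add: config_space_def space_PiM)

lemma measurable_rho: "measurable \<rho> M = measurable config_space M" "measurable M \<rho> = measurable M config_space"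
  by (rule measurable_cong_sets; simp add: sets_rho)+

lemma coordinate_measurable [measurable]: "(\<lambda>\<sigma>. \<sigma> x) \<in> measurable \<rho> (count_space UNIV)"
  unfolding measurable_rho config_space_def by measurable

lemma sets_Collect_pred: "Measurable.pred \<rho> P \<Longrightarrow> {\<sigma>. P \<sigma>} \<in> events"
  unfolding pred_def by simp

lemma translate_measurable [measurable]: "translate a \<in> measurable \<rho> \<rho>"
  unfolding measurable_rho(2) translate_def by (rule measurable_config) measurable

lemma prob_translate:
  assumes "A \<in> events" shows "prob (translate a -` A) = prob A"
proof -
  have "distr \<rho> config_space (translate a) = \<rho>"
    using ergodic_rho unfolding ergodic_def translation_invariant_def by blast
  then have "prob A = measure (distr \<rho> config_space (translate a)) A" by simp
  also have "\<dots> = prob (translate a -` A)"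
    using assms translate_measurable[of a] by (subst measure_distr) (auto simp: sets_rho measurable_rho(2))
  finally show ?thesis by simp
qed

lemma prob_translate_Collect:
  assumes "Measurable.pred \<rho> P" shows "prob {\<sigma>. P (translate a \<sigma>)} = prob {\<sigma>. P \<sigma>}"
  using prob_translate[OF sets_Collect_pred[OF assms], of a] by (simp add: vimage_def)

lemma zero_one:
  assumes "Measurable.pred \<rho> P" and "\<And>a \<sigma>. P (translate a \<sigma>) \<longleftrightarrow> P \<sigma>"
  shows "prob {\<sigma>. P \<sigma>} = 0 \<or> prob {\<sigma>. P \<sigma>} = 1"
proof -
  have "{\<sigma>. P \<sigma>} \<in> sets config_space" using sets_Collect_pred[OF assms(1)] sets_rho by simp
  moreover have "\<forall>a. translate a -` {\<sigma>. P \<sigma>} = {\<sigma>. P \<sigma>}" using assms(2) by auto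
  ultimately show ?thesis using ergodic_rho unfolding ergodic_def by blast
qed

lemma override_measurable [measurable]: "(\<lambda>\<sigma>. override_on \<sigma> \<eta> \<Delta>) \<in> measurable \<rho> \<rho>"
  unfolding measurable_rho(2)
proof (rule measurable_config)
  show "(\<lambda>\<sigma>. override_on \<sigma> \<eta> \<Delta> x) \<in> measurable \<rho> (count_space UNIV)" for x
    by (cases "x \<in> \<Delta>") simp_all
qed

text \<open>Overriding erases the values on \<open>\<Delta>\<close>, so membership depends only on
  the restriction to the complement. This permits integrating the conditional expectation over the
  event.\<close>

lemma override_vimage_off_algebra:
  assumes "G \<in> events" shows "{\<sigma>. override_on \<sigma> \<eta> \<Delta> \<in> G} \<in> sets (off_algebra \<Delta>)"
proof -
  let ?M = "\<Pi>\<^sub>M x\<in>- \<Delta>. count_space (UNIV :: bool set)"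
  let ?g = "\<lambda>\<tau>. override_on \<tau> \<eta> \<Delta>"
  have "?g \<in> measurable ?M config_space"
  proof (rule measurable_config)
    show "(\<lambda>\<tau>. override_on \<tau> \<eta> \<Delta> x) \<in> measurable ?M (count_space UNIV)" for x
      by (cases "x \<in> \<Delta>") (auto intro: measurable_component_singleton)
  qed
  then have "?g -` G \<inter> space ?M \<in> sets ?M" using assms sets_rho by (auto intro: measurable_sets)
  moreover have "{\<sigma>. override_on \<sigma> \<eta> \<Delta> \<in> G} = (\<lambda>\<sigma>. restrict \<sigma> (- \<Delta>)) -` (?g -` G \<inter> space ?M) \<inter> UNIV"
  proof -
    have "override_on (restrict \<sigma> (- \<Delta>)) \<eta> \<Delta> = override_on \<sigma> \<eta> \<Delta>" for \<sigma>
      by (auto simp: override_on_def fun_eq_iff)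
    moreover have "restrict \<sigma> (- \<Delta>) \<in> space ?M" for \<sigma> :: config by (auto simp: space_PiM)
    ultimately show ?thesis by auto
  qed
  ultimately show ?thesis
    unfolding off_algebra_def by (metis in_vimage_algebra)
qed

text \<open>The form in which finite energy is applied: a local modification keeps positive
  probability. The event that overriding leads into \<open>G\<close> contains \<open>E\<close> and
  is determined off \<open>\<Delta>\<close>. Conditionally on the outside, agreement with
  \<open>\<eta>\<close> has positive probability, and then overriding changes nothing.\<close>

lemma finite_energy_insertion:
  assumes "finite \<Delta>" "E \<in> events" "prob E > 0" "G \<in> events"
    and "\<And>\<sigma>. \<sigma> \<in> E \<Longrightarrow> override_on \<sigma> \<eta> \<Delta> \<in> G"
  shows "prob G > 0"
proof -
  let ?F = "{\<sigma>. override_on \<sigma> \<eta> \<Delta> \<in> G}" and ?A = "agree_on \<Delta> \<eta>"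
  let ?c = "real_cond_exp \<rho> (off_algebra \<Delta>) (indicator ?A)"
  have sub: "subalgebra \<rho> (off_algebra \<Delta>)" by (rule subalgebra_off_algebra[OF sets_rho])
  interpret finite_measure_subalgebra \<rho> "off_algebra \<Delta>"
    by unfold_locales (rule sub)
  have F: "?F \<in> sets (off_algebra \<Delta>)" by (rule override_vimage_off_algebra[OF assms(4)])
  then have Fe: "?F \<in> events" using sub by (auto simp: subalgebra_def)
  have A: "?A \<in> events" using agree_on_sets[OF assms(1)] sets_rho by simp
  have "prob ?F \<ge> prob E" using assms(5) Fe by (intro finite_measure_mono) auto
  then have pF: "prob ?F > 0" using assms(3) by simp
  have int: "integrable \<rho> (indicator ?A :: config \<Rightarrow> real)" using A by (auto simp: integrable_indicator_iff less_top[symmetric])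
  have "prob (?F \<inter> ?A) > 0"
  proof (rule ccontr)
    assume "\<not> ?thesis"
    then have z: "prob (?F \<inter> ?A) = 0" using zero_less_measure_iff by blast
    \<comment> \<open>If the intersection were null, an almost surely positive function would
      integrate to zero over \<open>?F\<close>, which has positive probability.\<close>
    have "(\<integral>\<sigma>\<in>?F. ?c \<sigma> \<partial>\<rho>) = (\<integral>\<sigma>\<in>?F. indicator ?A \<sigma> \<partial>\<rho>)"
      using real_cond_exp_intA[OF int F] by simp
    also have "\<dots> = (\<integral>\<sigma>. indicator (?F \<inter> ?A) \<sigma> \<partial>\<rho>)"
      unfolding set_lebesgue_integral_def by (simp add: indicator_inter_arith[symmetric] Int_commute)
    also have "\<dots> = 0" using z by simp
    finally have "(\<integral>\<sigma>. indicator ?F \<sigma> * ?c \<sigma> \<partial>\<rho>) = 0" by (simp add: set_lebesgue_integral_def)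
    moreover have pos: "AE \<sigma> in \<rho>. ?c \<sigma> > 0"
      using finite_energy_rho assms(1) by (auto simp: finite_energy_def)
    moreover have "integrable \<rho> (\<lambda>\<sigma>. indicator ?F \<sigma> * ?c \<sigma>)"
      using integrable_mult_indicator[OF Fe real_cond_exp_int(1)[OF int]] by simp
    moreover have "AE \<sigma> in \<rho>. 0 \<le> indicator ?F \<sigma> * ?c \<sigma>" using pos by eventually_elim auto
    ultimately have "AE \<sigma> in \<rho>. indicator ?F \<sigma> * ?c \<sigma> = 0"
      using integral_nonneg_eq_0_iff_AE by blast
    with pos have "AE \<sigma> in \<rho>. \<sigma> \<notin> ?F" by eventually_elim (auto simp: indicator_def)
    then have "prob ?F = 0" using prob_eq_0[OF Fe] by simp
    then show False using pF by simp
  qed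
  also have "prob (?F \<inter> ?A) \<le> prob G"
  proof (rule finite_measure_mono[OF _ assms(4)])
    have "override_on \<sigma> \<eta> \<Delta> = \<sigma>" if "\<sigma> \<in> ?A" for \<sigma>
      using that by (auto simp: agree_on_def override_on_def fun_eq_iff)
    then show "?F \<inter> ?A \<subseteq> G" by auto
  qed
  finally show ?thesis .
qed

text \<open>Positive association for the complements of \<open>A\<close> and \<open>B\<close>. For
  the zeros these are increasing; for the ones inclusion-exclusion carries the inequality over from
  \<open>A\<close> and \<open>B\<close>.\<close>

lemma square_root_trick:
  assumes "A \<in> events" "B \<in> events" "type_increasing v A" "type_increasing v B"
  shows "(1 - prob A) * (1 - prob B) \<le> 1 - prob (A \<union> B)"
proof -
  have pa: "prob C * prob D \<le> prob (C \<inter> D)" if "C \<in> events" "D \<in> events" "increasing C" "increasing D" for C D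
    using positively_associated_rho that sets_rho by (auto simp: positively_associated_def)
  show ?thesis
  proof (cases v)
    case True
    then have "prob A * prob B \<le> prob (A \<inter> B)" using assms by (intro pa) (auto simp: type_increasing_True)
    moreover have "prob (A \<union> B) = prob A + prob B - prob (A \<inter> B)"
      using assms by (simp add: measure_Un3 fmeasurable_eq_sets)
    ultimately show ?thesis by (simp add: algebra_simps)
  next
    case False
    have c: "prob (- C) = 1 - prob C" if "C \<in> events" for C
      using prob_compl[OF that] by (simp add: Compl_eq_Diff_UNIV)
    have "- A \<in> events" "- B \<in> events"
      using assms sets.compl_sets[of _ \<rho>] by (auto simp: Compl_eq_Diff_UNIV)
    then have "prob (- A) * prob (- B) \<le> prob (- A \<inter> - B)"
      using assms False by (intro pa) (auto simp: type_increasing_False)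
    also have "- A \<inter> - B = - (A \<union> B)" by simp
    finally show ?thesis using assms by (simp only: c sets.Un)
  qed
qed

section \<open>Measurability of connection events and elementary probability bounds\<close>

lemma prob_Collect_pos_ex:
  fixes P :: "'i::countable \<Rightarrow> config \<Rightarrow> bool"
  assumes [measurable]: "\<And>i. Measurable.pred \<rho> (P i)" and "prob {\<sigma>. \<exists>i. P i \<sigma>} > 0"
  shows "\<exists>i. prob {\<sigma>. P i \<sigma>} > 0"
proof (rule ccontr)
  assume "\<not> ?thesis"
  then have "prob {\<sigma>. P i \<sigma>} = 0" for i using zero_less_measure_iff by blast
  then have "AE \<sigma> in \<rho>. \<not> P i \<sigma>" for i
    using prob_eq_0[OF sets_Collect_pred[OF assms(1)]] by simp
  then have "AE \<sigma> in \<rho>. \<not> (\<exists>i. P i \<sigma>)" by (simp add: AE_all_countable)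
  moreover have "{\<sigma>. \<exists>i. P i \<sigma>} \<in> events" by (intro sets_Collect_pred) measurable
  ultimately have "prob {\<sigma>. \<exists>i. P i \<sigma>} = 0" using prob_eq_0 by simp
  then show False using assms(2) by simp
qed

lemma AE_eventually_prob:
  fixes P :: "nat \<Rightarrow> config \<Rightarrow> bool"
  assumes [measurable]: "\<And>i. Measurable.pred \<rho> (P i)"
    and "AE \<sigma> in \<rho>. \<exists>n. \<forall>m\<ge>n. P m \<sigma>" and "\<epsilon> > 0"
  shows "\<exists>n. \<forall>m\<ge>n. prob {\<sigma>. P m \<sigma>} > 1 - \<epsilon>"
proof -
  let ?A = "\<lambda>n. {\<sigma>. \<forall>m\<ge>n. P m \<sigma>}"
  have ev: "?A n \<in> events" for n by (intro sets_Collect_pred) measurable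
  have "(\<lambda>n. prob (?A n)) \<longlonglongrightarrow> prob (\<Union>n. ?A n)"
    by (rule finite_Lim_measure_incseq) (use ev in \<open>auto simp: incseq_def intro: order_trans\<close>)
  moreover have "prob (\<Union>n. ?A n) = 1"
    using assms(2) by (subst prob_eq_1) (use ev in auto)
  ultimately have "\<forall>\<^sub>F n in sequentially. prob (?A n) > 1 - \<epsilon>"
    using assms(3) by (intro order_tendstoD(1)) auto
  then obtain n where n: "prob (?A n) > 1 - \<epsilon>" by (auto simp: eventually_sequentially)
  have "prob (?A n) \<le> prob {\<sigma>. P m \<sigma>}" if "m \<ge> n" for m
    by (intro finite_measure_mono sets_Collect_pred) (use that in auto)
  then show ?thesis using n by (meson less_le_trans)
qed

text \<open>A connection uses finitely many sites, so the event is a countable union of cylinders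
  over the possible finite sets \<open>F\<close>.\<close>

lemma con_measurable [measurable]: "Measurable.pred \<rho> (\<lambda>\<sigma>. con R (\<sigma> -` {v} \<inter> D) x y)"
proof -
  let ?I = "{F. finite F \<and> F \<subseteq> D \<and> con R F x y}"
  have "{\<sigma>. con R (\<sigma> -` {v} \<inter> D) x y} = (\<Union>F\<in>?I. agree_on F (\<lambda>_. v))"
    unfolding con_finite_iff[of R "_ \<inter> D"] by (auto simp: agree_on_def)
  moreover have "countable ?I"
    by (rule countable_subset[OF _ countable_Collect_finite]) auto
  then have "(\<Union>F\<in>?I. agree_on F (\<lambda>_. v)) \<in> events"
    by (rule sets.countable_UN') (use agree_on_sets sets_rho in auto)
  ultimately show ?thesis by (simp add: pred_def)
qed

lemma infinite_con_measurable [measurable]: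
  "Measurable.pred \<rho> (\<lambda>\<sigma>. infinite {y. con R (\<sigma> -` {v} \<inter> D) x y})"
  unfolding infinite_iff_unbounded[where c = "(0, 0)"] mem_Collect_eq by measurable

lemma prob_Collect_conj_ge:
  assumes "Measurable.pred \<rho> P" "Measurable.pred \<rho> Q" "prob {\<sigma>. P \<sigma>} \<ge> a" "prob {\<sigma>. Q \<sigma>} \<ge> b"
  shows "prob {\<sigma>. P \<sigma> \<and> Q \<sigma>} \<ge> a + b - 1"
proof -
  have ev: "{\<sigma>. P \<sigma>} \<in> events" "{\<sigma>. Q \<sigma>} \<in> events" using assms by (auto intro: sets_Collect_pred)
  then have "prob ({\<sigma>. P \<sigma>} \<union> {\<sigma>. Q \<sigma>}) = prob {\<sigma>. P \<sigma>} + prob {\<sigma>. Q \<sigma>} - prob ({\<sigma>. P \<sigma>} \<inter> {\<sigma>. Q \<sigma>})"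
    by (simp add: measure_Un3 fmeasurable_eq_sets)
  moreover have "prob ({\<sigma>. P \<sigma>} \<union> {\<sigma>. Q \<sigma>}) \<le> 1" by simp
  moreover have "{\<sigma>. P \<sigma>} \<inter> {\<sigma>. Q \<sigma>} = {\<sigma>. P \<sigma> \<and> Q \<sigma>}" by auto
  ultimately show ?thesis using assms by simp
qed

lemma prob_Collect_mono:
  assumes "Measurable.pred \<rho> Q" "\<And>\<sigma>. P \<sigma> \<Longrightarrow> Q \<sigma>" shows "prob {\<sigma>. P \<sigma>} \<le> prob {\<sigma>. Q \<sigma>}"
  using assms by (intro finite_measure_mono sets_Collect_pred) auto

text \<open>\<open>N\<close> disjoint events of probability \<open>q\<close> force
  \<open>N * q \<le> 1\<close> for every \<open>N\<close>. With horizontal translates this takes the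
  place of ergodicity along the strip.\<close>

lemma disjoint_stationary_null:
  assumes [measurable]: "\<And>n::nat. Measurable.pred \<rho> (Q n)"
    and disj: "\<And>m n \<sigma>. Q m \<sigma> \<Longrightarrow> Q n \<sigma> \<Longrightarrow> m = n"
    and eq: "\<And>n. prob {\<sigma>. Q n \<sigma>} = q"
  shows "q = 0"
proof (rule ccontr)
  assume "q \<noteq> 0"
  then have q: "q > 0" using eq[of 0] measure_nonneg[of \<rho> "{\<sigma>. Q 0 \<sigma>}"] by simp
  obtain N :: nat where N: "real N * q > 1" using reals_Archimedean3[OF q] by blast
  have "prob (\<Union>n\<in>{..<N}. {\<sigma>. Q n \<sigma>}) = (\<Sum>n\<in>{..<N}. prob {\<sigma>. Q n \<sigma>})"
  proof (rule finite_measure_finite_Union)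
    show "(\<lambda>n. {\<sigma>. Q n \<sigma>}) ` {..<N} \<subseteq> events" by (auto intro!: sets_Collect_pred)
    show "disjoint_family_on (\<lambda>n. {\<sigma>. Q n \<sigma>}) {..<N}" using disj by (auto simp: disjoint_family_on_def)
  qed simp
  also have "\<dots> = real N * q" by (simp add: eq)
  finally show False using N prob_le_1[of "\<Union>n\<in>{..<N}. {\<sigma>. Q n \<sigma>}"] by linarith
qed

end

section \<open>Clusters of one type\<close>

text \<open>Covers the zeros with adjacency and the ones with star adjacency.
  \<open>adjacent_imp_R\<close> makes filled squares connected; \<open>R_imp_star_adjacent\<close>
  bounds the length of a step, so that a connection cannot jump over a blocked column.\<close>

locale percolation_type = percolation +
  fixes R :: "site \<Rightarrow> site \<Rightarrow> bool" and v :: bool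
  assumes adjacent_imp_R: "adjacent x y \<Longrightarrow> R x y"
    and R_imp_star_adjacent: "R x y \<Longrightarrow> star_adjacent x y"
    and symp_R: "symp R"
    and R_shift: "R (x + a) (y + a) = R x y"
begin

abbreviation conn :: "site set \<Rightarrow> config \<Rightarrow> site \<Rightarrow> site \<Rightarrow> bool" where
  "conn D \<sigma> \<equiv> con R (\<sigma> -` {v} \<inter> D)"

abbreviation inf_conn :: "site set \<Rightarrow> config \<Rightarrow> site \<Rightarrow> bool" where
  "inf_conn D \<sigma> x \<equiv> infinite {y. conn D \<sigma> x y}"

lemma R_square: "R x y \<Longrightarrow> y \<in> square x 1"
  using R_imp_star_adjacent[of x y] by (auto simp: star_adjacent_iff square_def)

lemma conn_sym: "conn D \<sigma> x y \<Longrightarrow> conn D \<sigma> y x"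
  by (rule con_sym[OF symp_R])

lemma conn_mono: "conn D \<sigma> x y \<Longrightarrow> D \<subseteq> E \<Longrightarrow> conn E \<sigma> x y"
  by (rule con_mono) auto

lemma conn_square:
  assumes "x \<in> square c k" "y \<in> square c k" "square c k \<subseteq> \<sigma> -` {v} \<inter> D"
  shows "conn D \<sigma> x y"
  using con_mono_rel[OF con_square[OF assms]] adjacent_imp_R by blast

lemma conn_translate: "conn {z. z + a \<in> D} (translate a \<sigma>) x y \<longleftrightarrow> conn D \<sigma> (x + a) (y + a)"
proof -
  have "translate a \<sigma> -` {v} \<inter> {z. z + a \<in> D} = {z. z + a \<in> \<sigma> -` {v} \<inter> D}"
    by (auto simp: translate_def)
  then show ?thesis using con_shift[of R a "\<sigma> -` {v} \<inter> D"] R_shift by simp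
qed

lemma inf_conn_translate: "inf_conn {z. z + a \<in> D} (translate a \<sigma>) x \<longleftrightarrow> inf_conn D \<sigma> (x + a)"
proof -
  have "{y. conn {z. z + a \<in> D} (translate a \<sigma>) x y} = (\<lambda>y. y + a) -` {y. conn D \<sigma> (x + a) y}"
    unfolding conn_translate by auto
  moreover have "bij (\<lambda>y. y + a)" by (rule bij_plus_right)
  ultimately show ?thesis by (simp only: finite_vimage_iff)
qed

lemma conn_UNIV_translate:
  "conn UNIV (translate a \<sigma>) x y \<longleftrightarrow> conn UNIV \<sigma> (x + a) (y + a)"
  "inf_conn UNIV (translate a \<sigma>) x \<longleftrightarrow> inf_conn UNIV \<sigma> (x + a)"
  using conn_translate[where D = UNIV and a = a] inf_conn_translate[where D = UNIV and a = a] by simp_all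

lemma conn_override: "conn (- \<Delta>) (override_on \<sigma> \<eta> \<Delta>) = conn (- \<Delta>) \<sigma>"
proof -
  have "override_on \<sigma> \<eta> \<Delta> -` {v} \<inter> - \<Delta> = \<sigma> -` {v} \<inter> - \<Delta>" by (auto simp: override_on_def)
  then show ?thesis by simp
qed

text \<open>Cut the paths from \<open>x\<close> at their last visit to \<open>B\<close>. What
  remains starts at one of finitely many neighbours of \<open>B\<close>, so one of these has an
  infinite cluster off \<open>B\<close>.\<close>

lemma infinite_branch:
  assumes "finite B" "x \<in> B" "inf_conn UNIV \<sigma> x"
  shows "\<exists>u\<in>B. \<exists>a. R u a \<and> conn UNIV \<sigma> x a \<and> inf_conn (- B) \<sigma> a"
proof (rule ccontr)
  assume *: "\<not> ?thesis"
  let ?N = "{a. \<exists>u\<in>B. R u a \<and> conn UNIV \<sigma> x a}"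
  have "?N \<subseteq> (\<Union>u\<in>B. square u 1)" using R_square by auto
  from finite_subset[OF this] have "finite ?N" using assms(1) by simp
  moreover have "finite {y. conn (- B) \<sigma> a y}" if "a \<in> ?N" for a using * that by blast
  ultimately have "finite (B \<union> (\<Union>a\<in>?N. {y. conn (- B) \<sigma> a y}))" using assms(1) by blast
  moreover have "{y. conn UNIV \<sigma> x y} \<subseteq> B \<union> (\<Union>a\<in>?N. {y. conn (- B) \<sigma> a y})"
  proof
    fix y assume y: "y \<in> {y. conn UNIV \<sigma> x y}"
    show "y \<in> B \<union> (\<Union>a\<in>?N. {y. conn (- B) \<sigma> a y})"
    proof (cases "y \<in> B")
      case False
      from con_last_exit[OF y[unfolded mem_Collect_eq] False assms(2)]
      obtain u w where uw: "conn UNIV \<sigma> x u" "u \<in> B" "R u w" "con R (\<sigma> -` {v} \<inter> UNIV - B) w y" by blast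
      have 1: "conn (- B) \<sigma> w y" using uw(4) by (simp add: Diff_eq)
      have "conn UNIV \<sigma> u w"
        using con_in2[OF uw(1)] con_in1[OF 1] uw(3) by (intro con_step) auto
      then have "w \<in> ?N" using uw con_trans by blast
      then show ?thesis using 1 by blast
    qed simp
  qed
  ultimately show False using assms(3) finite_subset by blast
qed

text \<open>A filled square replaces the usual single site, so that no paths have to be routed
  inside it: three mutually disconnected infinite branches off the square suffice.\<close>

definition trifurcation :: "int \<Rightarrow> site \<Rightarrow> config \<Rightarrow> bool" where
  "trifurcation n c \<sigma> \<longleftrightarrow> (\<forall>u. u \<in> square c n \<longrightarrow> \<sigma> u = v) \<and>
     (\<exists>a b d. (\<exists>u. u \<in> square c n \<and> R u a) \<and> (\<exists>u. u \<in> square c n \<and> R u b) \<and> (\<exists>u. u \<in> square c n \<and> R u d) \<and>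
       inf_conn (- square c n) \<sigma> a \<and> inf_conn (- square c n) \<sigma> b \<and> inf_conn (- square c n) \<sigma> d \<and>
       \<not> conn (- square c n) \<sigma> a b \<and> \<not> conn (- square c n) \<sigma> a d \<and> \<not> conn (- square c n) \<sigma> b d)"

lemma trifurcation_measurable [measurable]: "Measurable.pred \<rho> (trifurcation n c)"
  unfolding trifurcation_def by measurable

lemma trifurcation_translate: "trifurcation n c (translate e \<sigma>) \<longleftrightarrow> trifurcation n (c + e) \<sigma>"
proof -
  have sq: "{z. z + e \<in> - square (c + e) n} = - square c n" "{z. z + e \<in> square (c + e) n} = square c n"
    by (auto simp: square_def)
  have mem: "x \<in> square c n \<longleftrightarrow> x + e \<in> square (c + e) n" for x by (auto simp: square_def)
  note tr = conn_translate[where a = e and D = "- square (c + e) n", unfolded sq] inf_conn_translate[where a = e and D = "- square (c + e) n", unfolded sq]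
  note all = all_ex_translate[where a = e]
  let ?B = "square (c + e) n"
  let ?Q = "\<lambda>a b d. (\<exists>u. u \<in> ?B \<and> R u a) \<and> (\<exists>u. u \<in> ?B \<and> R u b) \<and> (\<exists>u. u \<in> ?B \<and> R u d) \<and>
       inf_conn (- ?B) \<sigma> a \<and> inf_conn (- ?B) \<sigma> b \<and> inf_conn (- ?B) \<sigma> d \<and>
       \<not> conn (- ?B) \<sigma> a b \<and> \<not> conn (- ?B) \<sigma> a d \<and> \<not> conn (- ?B) \<sigma> b d"
  have ex3: "(\<exists>a b d. Q (a + e) (b + e) (d + e)) \<longleftrightarrow> (\<exists>a b d. Q a b d)" for Q :: "site \<Rightarrow> site \<Rightarrow> site \<Rightarrow> bool"
    by (metis diff_add_cancel)
  have nb: "(\<exists>u. u \<in> square c n \<and> R u x) \<longleftrightarrow> (\<exists>u. u \<in> ?B \<and> R u (x + e))" for x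
    using all(2)[of "\<lambda>u. u \<in> ?B \<and> R u (x + e)"] by (simp only: mem[symmetric] R_shift)
  have op: "(\<forall>u. u \<in> square c n \<longrightarrow> translate e \<sigma> u = v) \<longleftrightarrow> (\<forall>u. u \<in> ?B \<longrightarrow> \<sigma> u = v)"
    using all(1)[of "\<lambda>u. u \<in> ?B \<longrightarrow> \<sigma> u = v"] by (simp only: mem[symmetric] translate_def)
  show ?thesis unfolding trifurcation_def tr nb op using ex3[of ?Q] by (simp only:)
qed

section \<open>Counting trifurcations against the boundary of a large square\<close>

context
  fixes \<sigma> :: config and n W :: int and C :: "site set"
  assumes n: "0 \<le> n"
    and C_inside: "\<And>c. c \<in> C \<Longrightarrow> square c n \<subseteq> square (0, 0) (W - 1)"
    and C_disjoint: "\<And>c d. c \<in> C \<Longrightarrow> d \<in> C \<Longrightarrow> c \<noteq> d \<Longrightarrow> square c n \<inter> square d n = {}"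
    and C_trifurcation: "\<And>c. c \<in> C \<Longrightarrow> trifurcation n c \<sigma>"
begin

private abbreviation "\<Lambda> \<equiv> square (0, 0) W"
private abbreviation "Rim \<equiv> square (0, 0) W - square (0, 0) (W - 1)"
private abbreviation "B c \<equiv> square c n"
private abbreviation "G c \<equiv> conn (\<Lambda> - B c) \<sigma>"

text \<open>An infinite branch leaves the inner square, and a step changes each coordinate by at
  most one, so it cannot skip the rim.\<close>

private lemma branch_reaches_boundary:
  assumes "c \<in> C" "u \<in> B c" "R u a" "inf_conn (- B c) \<sigma> a"
  shows "\<exists>q\<in>Rim. G c a q"
proof -
  have "{y. conn (- B c) \<sigma> a y} \<noteq> {}" using assms(4) by force
  then have aS: "a \<in> \<sigma> -` {v} \<inter> - B c" using con_in1 by blast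
  have aL: "a \<in> \<Lambda>" using R_square[OF assms(3)] C_inside[OF assms(1)] assms(2)
    by (force simp: square_def)
  show ?thesis
  proof (cases "a \<in> square (0, 0) (W - 1)")
    case False
    then show ?thesis using aS aL by (intro bexI[of _ a] con_refl) auto
  next
    case True
    obtain y where y: "conn (- B c) \<sigma> a y" "y \<notin> square (0, 0) (W - 1)"
      using assms(4) finite_subset[OF _ finite_square] by (metis mem_Collect_eq subsetI)
    then obtain w w' where w: "con R ((\<sigma> -` {v} \<inter> - B c) \<inter> square (0, 0) (W - 1)) a w"
      "w' \<in> (\<sigma> -` {v} \<inter> - B c) - square (0, 0) (W - 1)" "R w w'"
      using con_exit[OF y(1) True] con_in2 by blast
    have "w' \<in> \<Lambda>" using R_square[OF w(3)] con_in2[OF w(1)] by (auto simp: square_def)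
    moreover have "G c a w" using w(1) by (rule con_mono) (auto simp: square_def)
    ultimately have "G c a w'" using w(2,3) con_in2 con_trans[OF _ con_step] by (metis Diff_iff Int_iff Compl_iff)
    then show ?thesis using \<open>w' \<in> \<Lambda>\<close> w(2) by blast
  qed
qed

private abbreviation touch :: "site \<Rightarrow> site \<Rightarrow> site \<Rightarrow> bool" where
  "touch c a d \<equiv> \<exists>u\<in>B d. G c a u"

private lemma square_open: "c \<in> C \<Longrightarrow> B c \<subseteq> \<sigma> -` {v}"
  using C_trifurcation[of c] by (auto simp: trifurcation_def)

private lemma square_avoids:
  assumes "c \<in> C" "d \<in> C" "c \<noteq> d" shows "B d \<subseteq> \<sigma> -` {v} \<inter> (\<Lambda> - B c)"
  using C_inside[OF assms(2)] C_disjoint[OF assms] square_open[OF assms(2)] square_mono[of "W - 1" W "(0, 0)"] by auto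

text \<open>A branch of \<open>d\<close> that avoids \<open>B c\<close>, together with the filled
  square \<open>B d\<close>, is connected off \<open>B c\<close>; so what it reaches on the rim is
  also reached from \<open>B d\<close> as seen from \<open>c\<close>.\<close>

private lemma untouched_branch:
  assumes cd: "c \<in> C" "d \<in> C" "c \<noteq> d" and u: "u \<in> B d" "R u a"
    and nt: "\<not> touch d a c" and q: "G d a q" and b: "b \<in> B d"
  shows "G c b q"
proof -
  have aS: "a \<in> \<sigma> -` {v} \<inter> (\<Lambda> - B d)" using con_in1[OF q] .
  have aB: "a \<notin> B c" using nt con_refl[OF aS] by blast
  have "con R ((\<sigma> -` {v} \<inter> (\<Lambda> - B d)) \<inter> - B c) a q"
  proof (rule ccontr)
    assume "\<not> ?thesis"
    then obtain w w' where w: "con R ((\<sigma> -` {v} \<inter> (\<Lambda> - B d)) \<inter> - B c) a w"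
      "w' \<in> (\<sigma> -` {v} \<inter> (\<Lambda> - B d)) - (- B c)" "R w w'"
      using con_exit[OF q, of "- B c"] aB by blast
    have "G d a w" using w(1) by (rule con_mono) auto
    moreover have "G d w w'" using w con_in2[OF w(1)] by (intro con_step) auto
    ultimately have "G d a w'" by (rule con_trans)
    then show False using nt w(2) by blast
  qed
  then have "G c a q" by (rule con_mono) auto
  moreover have "G c u a" using square_avoids[OF cd] u aS aB by (intro con_step) auto
  moreover have "G c b u" using conn_square[OF b u(1) square_avoids[OF cd]] .
  ultimately show ?thesis using con_trans by metis
qed

text \<open>The two branches are joined through the filled square \<open>B c\<close>, which lies off
  \<open>B d\<close>. So of two disconnected branches of \<open>d\<close> at most one touches
  \<open>B c\<close>.\<close>

private lemma at_most_one_touching: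
  assumes "c \<in> C" "d \<in> C" "c \<noteq> d" "touch d a c" "touch d b c" shows "G d a b"
proof -
  obtain u w where uw: "u \<in> B c" "G d a u" "w \<in> B c" "G d b w" using assms by blast
  have "G d u w" using conn_square[OF uw(1,3) square_avoids[of d c]] assms by auto
  then show ?thesis using uw conn_sym con_trans by metis
qed

text \<open>The boundary site assigned to a trifurcation is the largest of the minima of its three
  branches on the boundary. Two trifurcations cannot share it: seen from one of them, some branch
  of the other with a smaller minimum lies inside a single branch.\<close>

private definition mark :: "site \<Rightarrow> site \<Rightarrow> site \<Rightarrow> site \<Rightarrow> site \<Rightarrow> bool" where
  "mark c p a b d \<longleftrightarrow> p \<in> Rim \<and> (\<exists>u\<in>B c. R u a) \<and> (\<exists>u\<in>B c. R u b) \<and> (\<exists>u\<in>B c. R u d) \<and>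
     \<not> G c b d \<and> G c a p \<and> (\<forall>q\<in>Rim. G c a q \<longrightarrow> to_nat p \<le> to_nat q) \<and>
     (\<exists>q\<in>Rim. G c b q \<and> to_nat q < to_nat p) \<and> (\<exists>q\<in>Rim. G c d q \<and> to_nat q < to_nat p)"

text \<open>Disconnected branches share no rim site, so their three minima differ and one of them is
  the largest.\<close>

private lemma mark_exists:
  assumes "c \<in> C" shows "\<exists>p a b d. mark c p a b d"
proof -
  obtain a b d where abd: "\<exists>u\<in>B c. R u a" "\<exists>u\<in>B c. R u b" "\<exists>u\<in>B c. R u d"
    "inf_conn (- B c) \<sigma> a" "inf_conn (- B c) \<sigma> b" "inf_conn (- B c) \<sigma> d"
    and nc: "\<not> conn (- B c) \<sigma> a b" "\<not> conn (- B c) \<sigma> a d" "\<not> conn (- B c) \<sigma> b d"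
    using C_trifurcation[OF assms] unfolding trifurcation_def by blast
  have G: "conn (- B c) \<sigma> x y" if "G c x y" for x y using that by (rule conn_mono) auto
  have n1: "\<not> G c a b" "\<not> G c a d" "\<not> G c b d" "\<not> G c d b" "\<not> G c b a" "\<not> G c d a"
    using G nc conn_sym by blast+
  have min: "\<exists>m\<in>Rim. G c x m \<and> (\<forall>q\<in>Rim. G c x q \<longrightarrow> to_nat m \<le> to_nat q)"
    if x: "\<exists>u\<in>B c. R u x" "inf_conn (- B c) \<sigma> x" for x
  proof -
    obtain q where "q \<in> Rim \<and> G c x q" using branch_reaches_boundary[OF assms] x by blast
    from ex_has_least_nat[of "\<lambda>q. q \<in> Rim \<and> G c x q" q to_nat, OF this] show ?thesis by blast
  qed
  obtain k where k: "k \<in> Rim" "G c a k" "\<forall>q\<in>Rim. G c a q \<longrightarrow> to_nat k \<le> to_nat q"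
    using min[OF abd(1,4)] by blast
  obtain l where l: "l \<in> Rim" "G c b l" "\<forall>q\<in>Rim. G c b q \<longrightarrow> to_nat l \<le> to_nat q"
    using min[OF abd(2,5)] by blast
  obtain m where m: "m \<in> Rim" "G c d m" "\<forall>q\<in>Rim. G c d q \<longrightarrow> to_nat m \<le> to_nat q"
    using min[OF abd(3,6)] by blast
  have "k \<noteq> l" "k \<noteq> m" "l \<noteq> m" using k l m n1 conn_sym con_trans by metis+
  then have "to_nat k \<noteq> to_nat l" "to_nat k \<noteq> to_nat m" "to_nat l \<noteq> to_nat m" by simp_all
  then consider "to_nat l < to_nat k" "to_nat m < to_nat k" | "to_nat k < to_nat l" "to_nat m < to_nat l"
    | "to_nat k < to_nat m" "to_nat l < to_nat m" by linarith
  then show ?thesis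
  proof cases
    case 1 then have "mark c k a b d" unfolding mark_def using k l m abd n1 by blast
    then show ?thesis by blast
  next
    case 2 then have "mark c l b a d" unfolding mark_def using k l m abd n1 by blast
    then show ?thesis by blast
  next
    case 3 then have "mark c m d a b" unfolding mark_def using k l m abd n1 by blast
    then show ?thesis by blast
  qed
qed

text \<open>Of the two branches of \<open>d\<close> with smaller minima, at least one avoids
  \<open>B c\<close>. If the branch \<open>a\<close> of \<open>c\<close> touched \<open>B d\<close>,
  it would contain that branch, and a rim site below \<open>p\<close> would contradict the
  minimality of \<open>p\<close> in \<open>a\<close>.\<close>

private lemma mark_not_touch:
  assumes cd: "c \<in> C" "d \<in> C" "c \<noteq> d" and m: "mark c p a b e" "mark d p a' b' e'"
  shows "\<not> touch c a d"
proof
  assume "touch c a d"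
  then obtain w where w: "w \<in> B d" "G c a w" by blast
  have "\<not> (touch d b' c \<and> touch d e' c)"
    using at_most_one_touching[OF cd, of b' e'] m(2) unfolding mark_def by metis
  then obtain x q where x: "\<exists>u\<in>B d. R u x" "\<not> touch d x c" "q \<in> Rim" "G d x q" "to_nat q < to_nat p"
    using m(2) unfolding mark_def by metis
  then have "G c w q" using untouched_branch[OF cd] w by blast
  then have "G c a q" using w(2) con_trans by blast
  then show False using m(1) x(3,5) unfolding mark_def by (meson not_less)
qed

text \<open>The branch of \<open>d\<close> through \<open>p\<close> avoids \<open>B c\<close>, hence
  links \<open>B d\<close> to \<open>p\<close> off \<open>B c\<close>. As \<open>a\<close> also
  reaches \<open>p\<close>, it touches \<open>B d\<close>, contrary to
  \<open>mark_not_touch\<close>.\<close>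

private lemma mark_inj:
  assumes cd: "c \<in> C" "d \<in> C" and m: "mark c p a b e" "mark d p a' b' e'"
  shows "c = d"
proof (rule ccontr)
  assume ne: "c \<noteq> d"
  have 1: "\<not> touch c a d" by (rule mark_not_touch[OF cd ne m])
  have 2: "\<not> touch d a' c" by (rule mark_not_touch[OF cd(2,1) ne[symmetric] m(2,1)])
  have dd: "d \<in> B d" using n by (simp add: square_def)
  obtain u where u: "u \<in> B d" "R u a'" "G d a' p" "G c a p" using m by (auto simp: mark_def)
  have "G c d p" by (rule untouched_branch[OF cd ne u(1,2) 2 u(3) dd])
  then have "G c a d" using u(4) conn_sym con_trans by metis
  then show False using 1 dd by blast
qed

lemma card_trifurcations: "card C \<le> card (square (0, 0) W - square (0, 0) (W - 1))"
proof -
  obtain f where f: "\<And>c. c \<in> C \<Longrightarrow> \<exists>a b d. mark c (f c) a b d" using mark_exists by metis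
  have "inj_on f C" using f mark_inj by (metis inj_onI)
  moreover have "f ` C \<subseteq> Rim" using f by (auto simp: mark_def)
  ultimately show ?thesis by (intro card_inj_on_le[of f]) auto
qed

end

subsection \<open>Uniqueness of the infinite cluster\<close>

lemma inf_conn_in:
  assumes "inf_conn D \<sigma> x" shows "x \<in> \<sigma> -` {v} \<inter> D"
proof -
  have "{y. conn D \<sigma> x y} \<noteq> {}" using assms by (metis finite.emptyI)
  then show ?thesis using con_in1 by blast
qed

text \<open>The expected number of trifurcations would grow like an area, \<open>N ^ 2\<close>,
  while \<open>card_trifurcations\<close> bounds it by a perimeter of order
  \<open>N\<close>.\<close>

lemma trifurcation_null:
  assumes n: "0 \<le> n" shows "prob {\<sigma>. trifurcation n (0, 0) \<sigma>} = 0"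
proof (rule ccontr)
  let ?t = "prob {\<sigma>. trifurcation n (0, 0) \<sigma>}"
  assume "?t \<noteq> 0"
  then have t: "?t > 0" using zero_less_measure_iff by blast
  have eq: "prob {\<sigma>. trifurcation n c \<sigma>} = ?t" for c
    using prob_translate_Collect[of "trifurcation n (0, 0)" c]
    by (simp add: trifurcation_translate zero_prod_def[symmetric])
  \<comment> \<open>Side length of the squares: centres at distinct multiples of \<open>?m\<close>
    give disjoint squares.\<close>
  let ?m = "2 * n + 1"
  have bound: "real N ^ 2 * ?t \<le> 8 * ?m * (real N + 1)" for N :: nat
  proof -
    \<comment> \<open>The squares reach at most to \<open>?m * N + n\<close>, and
      \<open>?W - 1\<close> equals \<open>?m * N + 2 * n\<close>.\<close>
    let ?W = "?m * (int N + 1)"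
    let ?g = "\<lambda>(i, j). (?m * i, ?m * j)"
    let ?C = "?g ` ({1..int N} \<times> {1..int N})"
    have "inj_on ?g ({1..int N} \<times> {1..int N})" using n by (auto simp: inj_on_def)
    then have cardC: "card ?C = N ^ 2"
      by (simp add: card_image card_cartesian_product power2_eq_square)
    have fin: "finite ?C" by simp
    have inside: "square c n \<subseteq> square (0, 0) (?W - 1)" if c: "c \<in> ?C" for c
    proof -
      obtain i j where ij: "c = (?m * i, ?m * j)" "1 \<le> i" "i \<le> int N" "1 \<le> j" "j \<le> int N" using c by force
      define M where "M = ?m * int N"
      have b: "0 \<le> fst c" "fst c \<le> M" "0 \<le> snd c" "snd c \<le> M"
        unfolding M_def using ij n mult_left_mono[of i "int N" ?m] mult_left_mono[of j "int N" ?m] by simp_all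
      have W: "?W - 1 = M + 2 * n" by (simp add: M_def algebra_simps)
      show ?thesis unfolding W using b n by (auto simp: square_def)
    qed
    have disj: "square c n \<inter> square d n = {}" if c: "c \<in> ?C" and d: "d \<in> ?C" and ne: "c \<noteq> d" for c d
    proof -
      obtain i j where c: "c = (?m * i, ?m * j)" using c by auto
      obtain k l where d: "d = (?m * k, ?m * l)" using d by auto
      have far: "2 * n < \<bar>?m * x - ?m * y\<bar>" if "x \<noteq> y" for x y :: int
      proof -
        have "?m * 1 \<le> ?m * \<bar>x - y\<bar>" using that n by (intro mult_left_mono) auto
        also have "\<dots> = \<bar>?m * x - ?m * y\<bar>" using n by (simp add: right_diff_distrib[symmetric] abs_mult)
        finally show ?thesis by simp
      qed
      have "i \<noteq> k \<or> j \<noteq> l" using ne c d by auto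
      then have "2 * n < \<bar>fst c - fst d\<bar> \<or> 2 * n < \<bar>snd c - snd d\<bar>"
        using far[of i k] far[of j l] c d by auto
      then show ?thesis by (auto simp: square_def)
    qed
    let ?K = "card (square (0, 0) ?W - square (0, 0) (?W - 1))"
    have W: "0 \<le> ?W - 1" using n by (simp add: algebra_simps)
    have K: "real ?K = 8 * real_of_int ?W"
    proof -
      have "real ?K = real (card (square (0, 0) ?W)) - real (card (square (0, 0) (?W - 1)))"
        using square_mono[of "?W - 1" ?W "(0, 0)"] by (subst card_Diff_subset) (auto simp: card_mono of_nat_diff)
      also have "\<dots> = (2 * real_of_int ?W + 1)\<^sup>2 - (2 * real_of_int (?W - 1) + 1)\<^sup>2"
        using W by (simp only: card_square)
      also have "\<dots> = 8 * real_of_int ?W" unfolding power2_eq_square by (simp add: algebra_simps)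
      finally show ?thesis .
    qed
    define C where "C = ?C"
    note C_facts = cardC[folded C_def] fin[folded C_def] inside[folded C_def] disj[folded C_def]
    have count: "card {c \<in> C. trifurcation n c \<sigma>} \<le> ?K" for \<sigma>
      by (rule card_trifurcations[OF n]) (use C_facts in blast)+
    have sum: "(\<Sum>c\<in>C. indicator {\<sigma>. trifurcation n c \<sigma>} \<sigma>) = real (card {c \<in> C. trifurcation n c \<sigma>})" for \<sigma>
      using C_facts(2) by (simp add: indicator_def sum.If_cases Int_def)
    have ev: "{\<sigma>. trifurcation n c \<sigma>} \<in> events" for c by (intro sets_Collect_pred) measurable
    have int: "integrable \<rho> (indicator {\<sigma>. trifurcation n c \<sigma>} :: config \<Rightarrow> real)" for c
      using ev by (auto simp: integrable_indicator_iff less_top[symmetric])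
    have "real N ^ 2 * ?t = (\<Sum>c\<in>C. prob {\<sigma>. trifurcation n c \<sigma>})"
    proof -
      have "(\<Sum>c\<in>C. prob {\<sigma>. trifurcation n c \<sigma>}) = (\<Sum>c\<in>C. ?t)" by (rule sum.cong[OF refl eq])
      then show ?thesis using C_facts(1) by simp
    qed
    also have "\<dots> = (\<Sum>c\<in>C. \<integral>\<sigma>. indicator {\<sigma>. trifurcation n c \<sigma>} \<sigma> \<partial>\<rho>)"
      using ev by simp
    also have "\<dots> = (\<integral>\<sigma>. (\<Sum>c\<in>C. indicator {\<sigma>. trifurcation n c \<sigma>} \<sigma>) \<partial>\<rho>)"
      by (rule Bochner_Integration.integral_sum[symmetric]) (rule int)
    also have "\<dots> \<le> real ?K"
    proof (rule integral_le_const)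
      show "integrable \<rho> (\<lambda>\<sigma>. \<Sum>c\<in>C. indicator {\<sigma>. trifurcation n c \<sigma>} \<sigma> :: real)"
        by (intro Bochner_Integration.integrable_sum int)
      show "AE \<sigma> in \<rho>. (\<Sum>c\<in>C. indicator {\<sigma>. trifurcation n c \<sigma>} \<sigma>) \<le> real ?K"
        unfolding sum using count by simp
    qed
    also have "\<dots> = 8 * ?m * (real N + 1)" unfolding K by simp
    finally show ?thesis .
  qed
  \<comment> \<open>The 16 is twice the 8 from the size of the rim; the factor two absorbs
    \<open>N + 1 \<le> 2 * N\<close>.\<close>
  obtain N :: nat where N: "real N > 16 * ?m / ?t" using reals_Archimedean2 by blast
  have m: "real_of_int ?m > 0" using n by simp
  have "16 * ?m / ?t > 0" using m t by (intro divide_pos_pos) auto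
  then have "real N > 0" using N by linarith
  then have N1: "real N \<ge> 1" by simp
  have "8 * ?m * (real N + 1) \<le> 8 * ?m * (2 * real N)" using N1 m by (intro mult_left_mono) auto
  also have "\<dots> = 16 * ?m * real N" by simp
  also have "16 * ?m * real N < (real N * ?t) * real N"
    using N t N1 by (intro mult_strict_right_mono) (auto simp: field_simps)
  also have "\<dots> = real N ^ 2 * ?t" by (simp add: power2_eq_square)
  finally show False using bound[of N] by simp
qed

definition several :: "config \<Rightarrow> bool" where
  "several \<sigma> \<longleftrightarrow> (\<exists>x y. inf_conn UNIV \<sigma> x \<and> inf_conn UNIV \<sigma> y \<and> \<not> conn UNIV \<sigma> x y)"

definition at_least_three :: "config \<Rightarrow> bool" where
  "at_least_three \<sigma> \<longleftrightarrow> (\<exists>x y z. inf_conn UNIV \<sigma> x \<and> inf_conn UNIV \<sigma> y \<and> inf_conn UNIV \<sigma> z \<and>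
     \<not> conn UNIV \<sigma> x y \<and> \<not> conn UNIV \<sigma> x z \<and> \<not> conn UNIV \<sigma> y z)"

lemma several_measurable [measurable]: "Measurable.pred \<rho> several"
  unfolding several_def by measurable

lemma at_least_three_measurable [measurable]: "Measurable.pred \<rho> at_least_three"
  unfolding at_least_three_def by measurable

text \<open>Otherwise some fixed square contains sites of three infinite clusters with positive
  probability. Filling it creates a trifurcation: the branches come from different clusters of the
  original configuration, hence are disconnected off the square.\<close>

lemma at_least_three_null: "prob {\<sigma>. at_least_three \<sigma>} = 0"
proof (rule ccontr)
  assume "\<not> ?thesis"
  then have pos: "prob {\<sigma>. at_least_three \<sigma>} > 0" using zero_less_measure_iff by blast
  let ?P = "\<lambda>(x, y, z) \<sigma>. inf_conn UNIV \<sigma> x \<and> inf_conn UNIV \<sigma> y \<and> inf_conn UNIV \<sigma> z \<and>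
     \<not> conn UNIV \<sigma> x y \<and> \<not> conn UNIV \<sigma> x z \<and> \<not> conn UNIV \<sigma> y z"
  have meas: "Measurable.pred \<rho> (?P i)" for i
    unfolding case_prod_beta by measurable
  have "{\<sigma>. at_least_three \<sigma>} = {\<sigma>. \<exists>i. ?P i \<sigma>}" by (auto simp: at_least_three_def)
  then have "prob {\<sigma>. \<exists>i. ?P i \<sigma>} > 0" using pos by simp
  from prob_Collect_pos_ex[OF meas this] obtain x y z where xyz: "prob {\<sigma>. ?P (x, y, z) \<sigma>} > 0" by auto
  obtain n :: nat where n: "{x, y, z} \<subseteq> square (0, 0) (int n)" using finite_subset_square[of "{x, y, z}"] by blast
  let ?B = "square (0, 0) (int n)"
  have "prob {\<sigma>. trifurcation (int n) (0, 0) \<sigma>} > 0"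
  proof (rule finite_energy_insertion[OF finite_square _ xyz])
    show "{\<sigma>. ?P (x, y, z) \<sigma>} \<in> events" using meas by (rule sets_Collect_pred)
    show "{\<sigma>. trifurcation (int n) (0, 0) \<sigma>} \<in> events" by (intro sets_Collect_pred) measurable
  next
    fix \<sigma> assume "\<sigma> \<in> {\<sigma>. ?P (x, y, z) \<sigma>}"
    then have s: "inf_conn UNIV \<sigma> x" "inf_conn UNIV \<sigma> y" "inf_conn UNIV \<sigma> z"
      "\<not> conn UNIV \<sigma> x y" "\<not> conn UNIV \<sigma> x z" "\<not> conn UNIV \<sigma> y z" by auto
    obtain u1 a where a: "u1 \<in> ?B" "R u1 a" "conn UNIV \<sigma> x a" "inf_conn (- ?B) \<sigma> a"
      using infinite_branch[OF _ _ s(1), of ?B] n by auto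
    obtain u2 b where b: "u2 \<in> ?B" "R u2 b" "conn UNIV \<sigma> y b" "inf_conn (- ?B) \<sigma> b"
      using infinite_branch[OF _ _ s(2), of ?B] n by auto
    obtain u3 d where d: "u3 \<in> ?B" "R u3 d" "conn UNIV \<sigma> z d" "inf_conn (- ?B) \<sigma> d"
      using infinite_branch[OF _ _ s(3), of ?B] n by auto
    have "\<not> conn (- ?B) \<sigma> a b" "\<not> conn (- ?B) \<sigma> a d" "\<not> conn (- ?B) \<sigma> b d"
      using s a b d conn_mono[of \<sigma> "- ?B"] conn_sym con_trans by (metis subset_UNIV)+
    then show "override_on \<sigma> (\<lambda>_. v) ?B \<in> {\<sigma>. trifurcation (int n) (0, 0) \<sigma>}"
      using a b d unfolding trifurcation_def conn_override mem_Collect_eq by (auto simp: override_on_def simp del: split_paired_Ex)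
  qed
  then show False using trifurcation_null[of "int n"] by simp
qed

text \<open>After filling, every infinite cluster meets the square. One that did not would already
  be present before, and so would be the cluster of \<open>x\<close> or of \<open>y\<close>; its
  path to that site, followed up to the square, survives the filling.\<close>

lemma merge_two_clusters:
  assumes "\<not> at_least_three \<sigma>" "inf_conn UNIV \<sigma> x" "inf_conn UNIV \<sigma> y" "\<not> conn UNIV \<sigma> x y"
    and B: "x \<in> square c n" "y \<in> square c n"
  shows "\<not> several (override_on \<sigma> (\<lambda>_. v) (square c n))"
proof -
  let ?B = "square c n"
  let ?\<tau> = "override_on \<sigma> (\<lambda>_. v) ?B"
  have meets: "\<exists>b\<in>?B. conn UNIV ?\<tau> w b" if w: "inf_conn UNIV ?\<tau> w" for w
  proof (rule ccontr)
    assume no: "\<not> ?thesis"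
    have "w \<in> ?\<tau> -` {v} \<inter> UNIV" using w by (rule inf_conn_in)
    from con_refl[OF this] have wB: "w \<in> - ?B" using no by blast
    have out: "conn (- ?B) \<sigma> w y" if y: "conn UNIV ?\<tau> w y" for y
    proof -
      have "con R (?\<tau> -` {v} \<inter> UNIV \<inter> - ?B) w y"
      proof (rule ccontr)
        assume "\<not> ?thesis"
        from con_exitE[OF y wB this] obtain a b where
          ab: "con R (?\<tau> -` {v} \<inter> UNIV \<inter> - ?B) w a" "b \<in> ?\<tau> -` {v} \<inter> UNIV - - ?B" "R a b" .
        have "conn UNIV ?\<tau> w a" using ab(1) by (rule con_mono) auto
        moreover have "conn UNIV ?\<tau> a b" using ab(2,3) con_in2[OF ab(1)] by (intro con_step) auto
        ultimately have "conn UNIV ?\<tau> w b" by (rule con_trans)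
        then show False using no ab(2) by auto
      qed
      then have "conn (- ?B) ?\<tau> w y" by simp
      then show ?thesis unfolding conn_override .
    qed
    have "{y. conn UNIV ?\<tau> w y} \<subseteq> {y. conn UNIV \<sigma> w y}" using out conn_mono by blast
    then have "inf_conn UNIV \<sigma> w" using w finite_subset by blast
    then have "conn UNIV \<sigma> w x \<or> conn UNIV \<sigma> w y"
      using assms(1-4) conn_sym unfolding at_least_three_def by blast
    then obtain z where z: "z \<in> ?B" "conn UNIV \<sigma> w z" using B by blast
    have "\<not> con R (\<sigma> -` {v} \<inter> UNIV \<inter> - ?B) w z" using con_in2 z(1) by blast
    from con_exitE[OF z(2) wB this] obtain a b where
      ab: "con R (\<sigma> -` {v} \<inter> UNIV \<inter> - ?B) w a" "b \<in> \<sigma> -` {v} \<inter> UNIV - - ?B" "R a b" .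
    have "conn (- ?B) \<sigma> w a" using ab(1) by simp
    then have a: "conn (- ?B) ?\<tau> w a" unfolding conn_override .
    have "conn UNIV ?\<tau> w a" using a by (rule conn_mono) auto
    moreover have "conn UNIV ?\<tau> a b" using ab(2,3) con_in2[OF a] by (intro con_step) (auto simp: override_on_def)
    ultimately have "conn UNIV ?\<tau> w b" by (rule con_trans)
    then show False using no ab(2) by auto
  qed
  have BB: "conn UNIV ?\<tau> b b'" if "b \<in> ?B" "b' \<in> ?B" for b b'
    by (rule conn_square[OF that]) (auto simp: override_on_def)
  show ?thesis
  proof
    assume "several ?\<tau>"
    then obtain w z where wz: "inf_conn UNIV ?\<tau> w" "inf_conn UNIV ?\<tau> z" "\<not> conn UNIV ?\<tau> w z"
      unfolding several_def by blast
    obtain b b' where "b \<in> ?B" "conn UNIV ?\<tau> w b" "b' \<in> ?B" "conn UNIV ?\<tau> z b'"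
      using meets wz(1,2) by blast
    then show False using BB wz(3) conn_sym con_trans by metis
  qed
qed

text \<open>By ergodicity, several infinite clusters would exist almost surely. They would be
  exactly two, and filling a square that meets both leaves a single one with positive
  probability.\<close>

lemma several_null: "prob {\<sigma>. several \<sigma>} = 0"
proof (rule ccontr)
  assume "\<not> ?thesis"
  moreover have "several (translate a \<sigma>) \<longleftrightarrow> several \<sigma>" for a \<sigma>
    unfolding several_def conn_UNIV_translate by (metis diff_add_cancel)
  then have "prob {\<sigma>. several \<sigma>} = 0 \<or> prob {\<sigma>. several \<sigma>} = 1" by (intro zero_one) measurable
  ultimately have one: "prob {\<sigma>. several \<sigma>} = 1" by blast
  have ev: "{\<sigma>. several \<sigma>} \<in> events" "{\<sigma>. at_least_three \<sigma>} \<in> events" "{\<sigma>. \<not> several \<sigma>} \<in> events"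
    by (intro sets_Collect_pred; measurable)+
  let ?P = "\<lambda>(x, y) \<sigma>. \<not> at_least_three \<sigma> \<and> inf_conn UNIV \<sigma> x \<and> inf_conn UNIV \<sigma> y \<and> \<not> conn UNIV \<sigma> x y"
  have meas: "Measurable.pred \<rho> (?P i)" for i
    unfolding case_prod_beta by measurable
  have "AE \<sigma> in \<rho>. several \<sigma>" using one prob_eq_1[OF ev(1)] by simp
  moreover have "AE \<sigma> in \<rho>. \<not> at_least_three \<sigma>" using at_least_three_null prob_eq_0[OF ev(2)] by simp
  ultimately have "AE \<sigma> in \<rho>. \<exists>i. ?P i \<sigma>" by eventually_elim (auto simp: several_def)
  moreover have "{\<sigma>. \<exists>i. ?P i \<sigma>} \<in> events"
    by (intro sets_Collect_pred pred_intros_countable(2) meas)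
  ultimately have "prob {\<sigma>. \<exists>i. ?P i \<sigma>} = 1" using prob_eq_1 by (simp only: mem_Collect_eq)
  then have "prob {\<sigma>. \<exists>i. ?P i \<sigma>} > 0" by linarith
  from prob_Collect_pos_ex[OF meas this] obtain x y where xy: "prob {\<sigma>. ?P (x, y) \<sigma>} > 0" by auto
  obtain n :: nat where n: "{x, y} \<subseteq> square (0, 0) (int n)" using finite_subset_square[of "{x, y}"] by blast
  have "prob {\<sigma>. \<not> several \<sigma>} > 0"
  proof (rule finite_energy_insertion[OF finite_square _ xy ev(3)])
    show "{\<sigma>. ?P (x, y) \<sigma>} \<in> events" using meas by (rule sets_Collect_pred)
    show "override_on \<sigma> (\<lambda>_. v) (square (0, 0) (int n)) \<in> {\<sigma>. \<not> several \<sigma>}" if "\<sigma> \<in> {\<sigma>. ?P (x, y) \<sigma>}" for \<sigma>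
      using that merge_two_clusters[of \<sigma> x y "(0, 0)" "int n"] n by auto
  qed
  moreover have "prob {\<sigma>. \<not> several \<sigma>} = 1 - prob {\<sigma>. several \<sigma>}"
    using prob_compl[OF ev(1)] by (simp add: Compl_eq_Diff_UNIV[symmetric] Collect_neg_eq)
  ultimately show False using one by simp
qed

lemma AE_unique: "AE \<sigma> in \<rho>. \<forall>x y. inf_conn UNIV \<sigma> x \<longrightarrow> inf_conn UNIV \<sigma> y \<longrightarrow> conn UNIV \<sigma> x y"
proof -
  have "{\<sigma>. several \<sigma>} \<in> events" by (intro sets_Collect_pred) measurable
  then have "AE \<sigma> in \<rho>. \<not> several \<sigma>" using several_null prob_eq_0 by simp
  then show ?thesis by eventually_elim (auto simp: several_def)
qed

subsection \<open>Exits from a strip\<close>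

text \<open>The two arms may run anywhere in the lattice, but the joining path stays in
  \<open>square c K\<close>; so it lies in the strip whenever that square does.\<close>

definition locally_unique :: "int \<Rightarrow> int \<Rightarrow> site \<Rightarrow> config \<Rightarrow> bool" where
  "locally_unique k K c \<sigma> \<longleftrightarrow> (\<forall>s t. s \<in> square c k \<longrightarrow> t \<in> square c k \<longrightarrow>
     (\<exists>y. y \<notin> square c K \<and> conn UNIV \<sigma> s y) \<longrightarrow> (\<exists>y. y \<notin> square c K \<and> conn UNIV \<sigma> t y) \<longrightarrow>
     conn (square c K) \<sigma> s t)"

lemma locally_unique_measurable [measurable]: "Measurable.pred \<rho> (locally_unique k K c)"
  unfolding locally_unique_def by measurable

lemma locally_unique_translate: "locally_unique k K c (translate a \<sigma>) \<longleftrightarrow> locally_unique k K (c + a) \<sigma>"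
proof -
  let ?c = "c + a"
  let ?E = "\<lambda>s. \<exists>y. y \<notin> square ?c K \<and> conn UNIV \<sigma> s y"
  have 1: "(\<exists>y. y \<notin> square c K \<and> conn UNIV (translate a \<sigma>) s y) \<longleftrightarrow> ?E (s + a)" for s
    using all_ex_translate(2)[of "\<lambda>y. y \<notin> square ?c K \<and> conn UNIV \<sigma> (s + a) y" a]
    by (simp only: conn_UNIV_translate square_translate)
  have 2: "conn (square c K) (translate a \<sigma>) s t \<longleftrightarrow> conn (square ?c K) \<sigma> (s + a) (t + a)" for s t
    using conn_translate[where D = "square ?c K" and a = a] by (simp only: square_translate Collect_mem_eq)
  let ?P = "\<lambda>s t. s \<in> square ?c k \<longrightarrow> t \<in> square ?c k \<longrightarrow> ?E s \<longrightarrow> ?E t \<longrightarrow> conn (square ?c K) \<sigma> s t"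
  have "(\<forall>s t. ?P (s + a) (t + a)) \<longleftrightarrow> (\<forall>s t. ?P s t)" by (metis diff_add_cancel)
  then show ?thesis unfolding locally_unique_def 1 2 by (simp only: square_translate)
qed

text \<open>Consider one pair of sites. If both clusters are infinite, a finite path joins them, and
  it lies in all large squares. If one is finite, it does not reach out of large squares. The small
  square contains finitely many pairs.\<close>

lemma AE_locally_unique: "AE \<sigma> in \<rho>. \<exists>n. \<forall>m\<ge>n. locally_unique k (int m) (0, 0) \<sigma>"
  using AE_unique
proof eventually_elim
  fix \<sigma> assume u: "\<forall>x y. inf_conn UNIV \<sigma> x \<longrightarrow> inf_conn UNIV \<sigma> y \<longrightarrow> conn UNIV \<sigma> x y"
  let ?E = "\<lambda>m s. \<exists>y. y \<notin> square (0, 0) (int m) \<and> conn UNIV \<sigma> s y"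
  let ?P = "\<lambda>m s t. ?E m s \<longrightarrow> ?E m t \<longrightarrow> conn (square (0, 0) (int m)) \<sigma> s t"
  have fin: "\<exists>n. \<forall>m\<ge>n. \<not> ?E m s" if s: "finite {y. conn UNIV \<sigma> s y}" for s
  proof -
    obtain n where n: "{y. conn UNIV \<sigma> s y} \<subseteq> square (0, 0) (int n)"
      using finite_subset_square[OF s] by blast
    have "\<not> ?E m s" if "m \<ge> n" for m
    proof -
      have "{y. conn UNIV \<sigma> s y} \<subseteq> square (0, 0) (int m)"
        using order_trans[OF n square_mono[of "int n" "int m" "(0, 0)"]] that by simp
      then show ?thesis by blast
    qed
    then show ?thesis by blast
  qed
  have "\<exists>n. \<forall>m\<ge>n. ?P m s t" for s t
  proof (cases "inf_conn UNIV \<sigma> s \<and> inf_conn UNIV \<sigma> t")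
    case True
    then have "conn UNIV \<sigma> s t" using u by blast
    from con_finite[OF this] obtain F where F: "finite F" "F \<subseteq> \<sigma> -` {v} \<inter> UNIV" "con R F s t" by blast
    obtain n where n: "F \<subseteq> square (0, 0) (int n)" using finite_subset_square[OF F(1)] by blast
    have "conn (square (0, 0) (int m)) \<sigma> s t" if "m \<ge> n" for m
      using F(3) by (rule con_mono) (use n F(2) square_mono[of "int n" "int m" "(0, 0)"] that in auto)
    then show ?thesis by blast
  next
    case False
    then have "finite {y. conn UNIV \<sigma> s y} \<or> finite {y. conn UNIV \<sigma> t y}" by simp
    then have "(\<exists>n. \<forall>m\<ge>n. \<not> ?E m s) \<or> (\<exists>n. \<forall>m\<ge>n. \<not> ?E m t)" using fin by blast
    then show ?thesis by blast
  qed
  then have "\<forall>\<^sub>F m in sequentially. \<forall>q\<in>square (0, 0) k \<times> square (0, 0) k. ?P m (fst q) (snd q)"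
    by (intro eventually_ball_finite) (auto simp: eventually_sequentially simp del: split_paired_Ex)
  then obtain N where N: "\<forall>m\<ge>N. \<forall>q\<in>square (0, 0) k \<times> square (0, 0) k. ?P m (fst q) (snd q)"
    unfolding eventually_sequentially by blast
  have "locally_unique k (int m) (0, 0) \<sigma>" if "m \<ge> N" for m
    unfolding locally_unique_def
  proof (intro allI impI)
    fix s t assume *: "s \<in> square (0, 0) k" "t \<in> square (0, 0) k" "?E m s" "?E m t"
    from N[rule_format, OF that, of "(s, t)"] show "conn (square (0, 0) (int m)) \<sigma> s t"
      unfolding fst_conv snd_conv mem_Times_iff using * by blast
  qed
  then show "\<exists>n. \<forall>m\<ge>n. locally_unique k (int m) (0, 0) \<sigma>" by blast
qed

lemma prob_locally_unique:
  assumes "\<epsilon> > 0" shows "\<exists>K\<ge>K0. \<forall>c. prob {\<sigma>. locally_unique k K c \<sigma>} \<ge> 1 - \<epsilon>"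
proof -
  obtain n where n: "\<forall>m\<ge>n. prob {\<sigma>. locally_unique k (int m) (0, 0) \<sigma>} > 1 - \<epsilon>"
    using AE_eventually_prob[OF locally_unique_measurable AE_locally_unique assms] by blast
  let ?K = "int (max n (nat K0))"
  have "prob {\<sigma>. locally_unique k ?K c \<sigma>} > 1 - \<epsilon>" for c
    using prob_translate_Collect[of "locally_unique k ?K (0, 0)" c] n
    by (simp add: locally_unique_translate zero_prod_def[symmetric])
  then show ?thesis by (intro exI[of _ ?K]) (auto intro: less_imp_le)
qed

definition hits :: "site \<Rightarrow> int \<Rightarrow> config \<Rightarrow> bool" where
  "hits c k \<sigma> \<longleftrightarrow> (\<exists>s. s \<in> square c k \<and> inf_conn UNIV \<sigma> s)"

lemma hits_measurable [measurable]: "Measurable.pred \<rho> (hits c k)"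
  unfolding hits_def by measurable

lemma hits_translate: "hits c k (translate a \<sigma>) \<longleftrightarrow> hits (c + a) k \<sigma>"
  using all_ex_translate(2)[of "\<lambda>s. s \<in> square (c + a) k \<and> inf_conn UNIV \<sigma> s" a]
  unfolding hits_def conn_UNIV_translate by (simp only: square_translate)

lemma prob_hits:
  assumes "AE \<sigma> in \<rho>. \<exists>x. inf_conn UNIV \<sigma> x" "\<epsilon> > 0"
  shows "\<exists>k\<ge>0. \<forall>c. prob {\<sigma>. hits c k \<sigma>} \<ge> 1 - \<epsilon>"
proof -
  have "AE \<sigma> in \<rho>. \<exists>n. \<forall>m\<ge>n. hits (0, 0) (int m) \<sigma>"
    using assms(1)
  proof eventually_elim
    fix \<sigma> assume "\<exists>x. inf_conn UNIV \<sigma> x"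
    then obtain x where x: "inf_conn UNIV \<sigma> x" by blast
    obtain n where n: "{x} \<subseteq> square (0, 0) (int n)" using finite_subset_square[of "{x}"] by blast
    have "hits (0, 0) (int m) \<sigma>" if "m \<ge> n" for m
    proof -
      have "x \<in> square (0, 0) (int m)" using n square_mono[of "int n" "int m" "(0, 0)"] that by auto
      then show ?thesis using x unfolding hits_def by blast
    qed
    then show "\<exists>n. \<forall>m\<ge>n. hits (0, 0) (int m) \<sigma>" by blast
  qed
  from AE_eventually_prob[OF _ this assms(2)]
  obtain n where n: "prob {\<sigma>. hits (0, 0) (int n) \<sigma>} > 1 - \<epsilon>" by auto
  have "prob {\<sigma>. hits c (int n) \<sigma>} > 1 - \<epsilon>" for c
    using prob_translate_Collect[of "hits (0, 0) (int n)" c] n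
    by (simp add: hits_translate zero_prod_def[symmetric])
  then show ?thesis by (intro exI[of _ "int n"]) (auto intro: less_imp_le)
qed

section \<open>Blocked columns of the strip\<close>

definition blocked :: "int \<Rightarrow> int \<Rightarrow> config \<Rightarrow> bool" where
  "blocked h x \<sigma> \<longleftrightarrow> (\<forall>y. 0 \<le> y \<and> y \<le> h \<longrightarrow> \<sigma> (x, y) \<noteq> v)"

lemma blocked_measurable [measurable]: "Measurable.pred \<rho> (blocked h x)"
  unfolding blocked_def by measurable

lemma blocked_translate: "blocked h x (translate (a, 0) \<sigma>) \<longleftrightarrow> blocked h (x + a) \<sigma>"
  by (simp add: blocked_def translate_def)

text \<open>The sign \<open>e\<close> selects the direction: the rightmost blocked column for
  \<open>1\<close>, the leftmost for \<open>-1\<close>.\<close>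

definition last_blocked :: "int \<Rightarrow> int \<Rightarrow> int \<Rightarrow> config \<Rightarrow> bool" where
  "last_blocked e h x \<sigma> \<longleftrightarrow> blocked h x \<sigma> \<and> (\<forall>x'. e * x < e * x' \<longrightarrow> \<not> blocked h x' \<sigma>)"

lemma last_blocked_measurable [measurable]: "Measurable.pred \<rho> (last_blocked e h x)"
  unfolding last_blocked_def by measurable

text \<open>A last blocked column is unique, yet by invariance all positions are equally likely for
  it.\<close>

lemma last_blocked_null:
  assumes e: "e = 1 \<or> e = -1"
  shows "prob {\<sigma>. last_blocked e h x \<sigma>} = 0"
proof -
  have "last_blocked e h y (translate (a, 0) \<sigma>) \<longleftrightarrow> last_blocked e h (y + a) \<sigma>" for y a \<sigma>
  proof -
    have "(\<forall>x'. e * y < e * x' \<longrightarrow> \<not> blocked h (x' + a) \<sigma>) \<longleftrightarrow> (\<forall>x'. e * (y + a) < e * x' \<longrightarrow> \<not> blocked h x' \<sigma>)"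
    proof (intro iffI allI impI)
      fix x' assume *: "\<forall>x'. e * y < e * x' \<longrightarrow> \<not> blocked h (x' + a) \<sigma>" "e * (y + a) < e * x'"
      from *(1)[rule_format, of "x' - a"] *(2) show "\<not> blocked h x' \<sigma>" by (simp add: algebra_simps)
    next
      fix x' assume *: "\<forall>x'. e * (y + a) < e * x' \<longrightarrow> \<not> blocked h x' \<sigma>" "e * y < e * x'"
      from *(1)[rule_format, of "x' + a"] *(2) show "\<not> blocked h (x' + a) \<sigma>" by (simp add: algebra_simps)
    qed
    then show ?thesis by (simp add: last_blocked_def blocked_translate)
  qed
  then have eq: "prob {\<sigma>. last_blocked e h y \<sigma>} = prob {\<sigma>. last_blocked e h x \<sigma>}" for y
    using prob_translate_Collect[of "last_blocked e h x" "(y - x, 0)"] by simp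
  show ?thesis
  proof (rule disjoint_stationary_null[of "\<lambda>n. last_blocked e h (int n)"])
    show "m = n" if "last_blocked e h (int m) \<sigma>" "last_blocked e h (int n) \<sigma>" for m n \<sigma>
      using that e unfolding last_blocked_def by (cases m n rule: linorder_cases) auto
  qed (use eq in auto)
qed

text \<open>If no column is blocked, closing column \<open>0\<close> makes it the only blocked one
  and thus the last. By finite energy this would have positive probability.\<close>

lemma AE_blocked_exists: "AE \<sigma> in \<rho>. \<exists>x. blocked h x \<sigma>"
proof -
  let ?N = "{\<sigma>. \<not> (\<exists>x. blocked h x \<sigma>)}" and ?\<Delta> = "{0::int} \<times> {0..h}"
  have ev: "?N \<in> events" by (intro sets_Collect_pred) measurable
  have "prob ?N = 0"
  proof (rule ccontr)
    assume "prob ?N \<noteq> 0"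
    then have pos: "prob ?N > 0" using zero_less_measure_iff by blast
    have "prob {\<sigma>. last_blocked 1 h 0 \<sigma>} > 0"
    proof (rule finite_energy_insertion[OF _ ev pos])
      show "finite ?\<Delta>" by simp
      show "{\<sigma>. last_blocked 1 h 0 \<sigma>} \<in> events" by (intro sets_Collect_pred) measurable
      show "override_on \<sigma> (\<lambda>_. \<not> v) ?\<Delta> \<in> {\<sigma>. last_blocked 1 h 0 \<sigma>}" if "\<sigma> \<in> ?N" for \<sigma>
        using that unfolding last_blocked_def blocked_def by (auto simp: override_on_def)
    qed
    then show False using last_blocked_null[of 1 h 0] by simp
  qed
  then show ?thesis using prob_eq_0[OF ev] by simp
qed

text \<open>Some column is blocked and none is the last one in either direction.\<close>

lemma AE_blocked: "AE \<sigma> in \<rho>. \<forall>x0. (\<exists>x>x0. blocked h x \<sigma>) \<and> (\<exists>x<x0. blocked h x \<sigma>)"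
proof -
  have "AE \<sigma> in \<rho>. \<not> last_blocked e h x \<sigma>" if "e = 1 \<or> e = -1" for e x
  proof -
    have "{\<sigma>. last_blocked e h x \<sigma>} \<in> events" by (intro sets_Collect_pred) measurable
    from prob_eq_0[OF this] show ?thesis using last_blocked_null[OF that, of h x] by simp
  qed
  then have "AE \<sigma> in \<rho>. \<forall>x. \<not> last_blocked 1 h x \<sigma>" "AE \<sigma> in \<rho>. \<forall>x. \<not> last_blocked (-1) h x \<sigma>"
    by (simp_all add: AE_all_countable)
  then show ?thesis
    using AE_blocked_exists[of h]
  proof eventually_elim
    fix \<sigma> assume n: "\<forall>x. \<not> last_blocked 1 h x \<sigma>" "\<forall>x. \<not> last_blocked (-1) h x \<sigma>" and "\<exists>x. blocked h x \<sigma>"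
    then obtain b where b: "blocked h b \<sigma>" by blast
    have "\<exists>x>x0. blocked h x \<sigma>" for x0
    proof (rule ccontr)
      assume no: "\<not> ?thesis"
      let ?A = "{b..x0} \<inter> {x. blocked h x \<sigma>}"
      have "b \<le> x0" using b no by (meson not_less)
      then have ne: "finite ?A" "?A \<noteq> {}" using b by auto
      have "last_blocked 1 h (Max ?A) \<sigma>"
        unfolding last_blocked_def
      proof (intro conjI allI impI notI)
        show "blocked h (Max ?A) \<sigma>" using Max_in[OF ne] by blast
        fix x' assume x': "1 * Max ?A < 1 * x'" "blocked h x' \<sigma>"
        have "b \<le> Max ?A" using Max_in[OF ne] by simp
        then have "x' \<in> ?A" using x' no by (auto simp: not_less)
        then show False using Max_ge[OF ne(1)] x'(1) by fastforce
      qed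
      then show False using n(1) by blast
    qed
    moreover have "\<exists>x<x0. blocked h x \<sigma>" for x0
    proof (rule ccontr)
      assume no: "\<not> ?thesis"
      let ?A = "{x0..b} \<inter> {x. blocked h x \<sigma>}"
      have "x0 \<le> b" using b no by (meson not_less)
      then have ne: "finite ?A" "?A \<noteq> {}" using b by auto
      have "last_blocked (-1) h (Min ?A) \<sigma>"
        unfolding last_blocked_def
      proof (intro conjI allI impI notI)
        show "blocked h (Min ?A) \<sigma>" using Min_in[OF ne] by blast
        fix x' assume x': "-1 * Min ?A < -1 * x'" "blocked h x' \<sigma>"
        have "Min ?A \<le> b" using Min_in[OF ne] by simp
        then have "x' \<in> ?A" using x' no by (auto simp: not_less)
        then show False using Min_le[OF ne(1)] x'(1) by fastforce
      qed
      then show False using n(2) by blast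
    qed
    ultimately show "\<forall>x0. (\<exists>x>x0. blocked h x \<sigma>) \<and> (\<exists>x<x0. blocked h x \<sigma>)" by blast
  qed
qed

text \<open>Two blocked columns cut a finite piece around \<open>s\<close> out of the strip. The
  infinite cluster leaves this piece, but not through the columns; so the last site before the exit
  lies in row \<open>0\<close> or row \<open>h\<close>.\<close>

lemma exits_strip:
  assumes bl: "\<forall>x0. (\<exists>x>x0. blocked h x \<sigma>) \<and> (\<exists>x<x0. blocked h x \<sigma>)"
    and s: "s \<in> strip h" "inf_conn UNIV \<sigma> s"
  shows "\<exists>x. conn (strip h) \<sigma> s (x, 0) \<or> conn (strip h) \<sigma> s (x, h)"
proof -
  obtain xr where xr: "fst s < xr" "blocked h xr \<sigma>" using bl by blast
  obtain xl where xl: "xl < fst s" "blocked h xl \<sigma>" using bl by blast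
  let ?D = "{xl<..<xr} \<times> {0..h}"
  have sD: "s \<in> ?D" using s(1) xr xl by (auto simp: strip_def mem_Times_iff)
  have Ds: "?D \<subseteq> strip h" by (auto simp: strip_def)
  have "finite ?D" by simp
  then have "\<not> {y. conn UNIV \<sigma> s y} \<subseteq> ?D" using s(2) finite_subset[of "{y. conn UNIV \<sigma> s y}" ?D] by blast
  then obtain y where y: "conn UNIV \<sigma> s y" "y \<notin> ?D" by blast
  have "\<not> con R (\<sigma> -` {v} \<inter> UNIV \<inter> ?D) s y"
  proof
    assume "con R (\<sigma> -` {v} \<inter> UNIV \<inter> ?D) s y"
    from con_in2[OF this] show False using y(2) by blast
  qed
  from con_exitE[OF y(1) sD this] obtain w w' where
    w: "con R (\<sigma> -` {v} \<inter> UNIV \<inter> ?D) s w" "w' \<in> \<sigma> -` {v} \<inter> UNIV - ?D" "R w w'" .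
  have wD: "w \<in> ?D" using con_in2[OF w(1)] by blast
  have near: "\<bar>fst w' - fst w\<bar> \<le> 1" "\<bar>snd w' - snd w\<bar> \<le> 1" using R_square[OF w(3)] by (auto simp: square_def)
  have "snd w' < 0 \<or> h < snd w'"
  proof (rule ccontr)
    assume in_h: "\<not> ?thesis"
    then have "\<not> (xl < fst w' \<and> fst w' < xr)" using w(2) by (auto simp: mem_Times_iff)
    then have "fst w' = xl \<or> fst w' = xr" using wD near by (auto simp: mem_Times_iff)
    then have "\<sigma> w' \<noteq> v" using xr(2) xl(2) in_h unfolding blocked_def by (metis not_less prod.collapse)
    then show False using w(2) by auto
  qed
  then have "snd w = 0 \<or> snd w = h" using wD near by (auto simp: mem_Times_iff)
  moreover have "conn (strip h) \<sigma> s w" using w(1) by (rule con_mono) (use Ds in auto)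
  ultimately show ?thesis by (metis prod.collapse)
qed

section \<open>Arms from a square to the sides of the strip\<close>

definition arm :: "int \<Rightarrow> site \<Rightarrow> int \<Rightarrow> int set \<Rightarrow> int \<Rightarrow> config \<Rightarrow> bool" where
  "arm h c k I r \<sigma> \<longleftrightarrow> (\<exists>s x. s \<in> square c k \<and> x \<in> I \<and> conn (strip h) \<sigma> s (x, r))"

lemma arm_measurable [measurable]: "Measurable.pred \<rho> (arm h c k I r)"
  unfolding arm_def by measurable

lemma arm_increasing: "type_increasing v {\<sigma>. arm h c k I r \<sigma>}"
  unfolding type_increasing_def
proof (intro allI impI)
  fix \<xi> \<eta> :: config assume *: "\<xi> \<in> {\<sigma>. arm h c k I r \<sigma>}" and sub: "\<xi> -` {v} \<subseteq> \<eta> -` {v}"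
  then obtain s x where sx: "s \<in> square c k" "x \<in> I" "conn (strip h) \<xi> s (x, r)" unfolding arm_def by blast
  have "conn (strip h) \<eta> s (x, r)" using sx(3) by (rule con_mono) (use sub in blast)
  then show "\<eta> \<in> {\<sigma>. arm h c k I r \<sigma>}" using sx unfolding arm_def by blast
qed

lemma conn_strip_translate:
  "conn (strip h) (translate (a, 0) \<sigma>) (x, y) (x', y') \<longleftrightarrow> conn (strip h) \<sigma> (x + a, y) (x' + a, y')"
proof -
  have "{z. z + (a, 0) \<in> strip h} = strip h" by (auto simp: strip_def)
  then show ?thesis using conn_translate[where D = "strip h" and a = "(a, 0)"] by simp
qed

lemma prob_arm_translate:
  "prob {\<sigma>. arm h (x + a, y) k I r \<sigma>} = prob {\<sigma>. arm h (x, y) k {z. z + a \<in> I} r \<sigma>}"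
proof -
  have "arm h (x, y) k {z. z + a \<in> I} r (translate (a, 0) \<sigma>) \<longleftrightarrow> arm h (x + a, y) k I r \<sigma>" for \<sigma>
  proof
    assume "arm h (x, y) k {z. z + a \<in> I} r (translate (a, 0) \<sigma>)"
    then obtain s1 s2 b where *: "(s1, s2) \<in> square (x, y) k" "b + a \<in> I"
      "conn (strip h) (translate (a, 0) \<sigma>) (s1, s2) (b, r)" unfolding arm_def by auto
    then have "(s1 + a, s2) \<in> square (x + a, y) k" by (auto simp: square_def)
    then show "arm h (x + a, y) k I r \<sigma>" using * unfolding arm_def conn_strip_translate by blast
  next
    assume "arm h (x + a, y) k I r \<sigma>"
    then obtain s1 s2 b where *: "(s1, s2) \<in> square (x + a, y) k" "b \<in> I"
      "conn (strip h) \<sigma> (s1, s2) (b, r)" unfolding arm_def by auto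
    then have "(s1 - a, s2) \<in> square (x, y) k" "b - a \<in> {z. z + a \<in> I}"
      "conn (strip h) (translate (a, 0) \<sigma>) (s1 - a, s2) (b - a, r)"
      unfolding conn_strip_translate by (auto simp: square_def)
    then show "arm h (x, y) k {z. z + a \<in> I} r (translate (a, 0) \<sigma>)" unfolding arm_def by blast
  qed
  then show ?thesis using prob_translate_Collect[of "arm h (x, y) k {z. z + a \<in> I} r" "(a, 0)"] by simp
qed

text \<open>If both events failed with probability above \<open>\<delta>\<close>, the square root
  trick would make them fail together with probability above
  \<open>\<delta>\<^sup>2\<close>.\<close>

lemma square_root_alternative:
  assumes "Measurable.pred \<rho> P" "Measurable.pred \<rho> Q"
    and "type_increasing v {\<sigma>. P \<sigma>}" "type_increasing v {\<sigma>. Q \<sigma>}"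
    and "prob {\<sigma>. P \<sigma> \<or> Q \<sigma>} \<ge> 1 - \<delta>\<^sup>2" "\<delta> > 0"
  shows "prob {\<sigma>. P \<sigma>} \<ge> 1 - \<delta> \<or> prob {\<sigma>. Q \<sigma>} \<ge> 1 - \<delta>"
proof (rule ccontr)
  assume "\<not> ?thesis"
  then have "\<delta> * \<delta> < (1 - prob {\<sigma>. P \<sigma>}) * (1 - prob {\<sigma>. Q \<sigma>})"
    using assms(6) by (intro mult_strict_mono) auto
  also have "\<dots> \<le> 1 - prob ({\<sigma>. P \<sigma>} \<union> {\<sigma>. Q \<sigma>})"
    using assms by (intro square_root_trick[where v = v] sets_Collect_pred)
  also have "{\<sigma>. P \<sigma>} \<union> {\<sigma>. Q \<sigma>} = {\<sigma>. P \<sigma> \<or> Q \<sigma>}" by auto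
  finally show False using assms(5) by (simp add: power2_eq_square)
qed

lemma arm_to_some_side:
  assumes "square c k \<subseteq> strip h" "prob {\<sigma>. hits c k \<sigma>} \<ge> 1 - \<delta>\<^sup>2" "\<delta> > 0"
  shows "prob {\<sigma>. arm h c k UNIV 0 \<sigma>} \<ge> 1 - \<delta> \<or> prob {\<sigma>. arm h c k UNIV h \<sigma>} \<ge> 1 - \<delta>"
proof -
  have "AE \<sigma> in \<rho>. hits c k \<sigma> \<longrightarrow> arm h c k UNIV 0 \<sigma> \<or> arm h c k UNIV h \<sigma>"
    using AE_blocked[of h]
  proof eventually_elim
    fix \<sigma> assume bl: "\<forall>x0. (\<exists>x>x0. blocked h x \<sigma>) \<and> (\<exists>x<x0. blocked h x \<sigma>)"
    show "hits c k \<sigma> \<longrightarrow> arm h c k UNIV 0 \<sigma> \<or> arm h c k UNIV h \<sigma>"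
    proof
      assume "hits c k \<sigma>"
      then obtain s where s: "s \<in> square c k" "inf_conn UNIV \<sigma> s" unfolding hits_def by blast
      then have "s \<in> strip h" using assms(1) by blast
      from exits_strip[OF bl this s(2)] show "arm h c k UNIV 0 \<sigma> \<or> arm h c k UNIV h \<sigma>"
        using s(1) unfolding arm_def by blast
    qed
  qed
  then have "prob {\<sigma>. hits c k \<sigma>} \<le> prob {\<sigma>. arm h c k UNIV 0 \<sigma> \<or> arm h c k UNIV h \<sigma>}"
    by (intro finite_measure_mono_AE sets_Collect_pred) (auto, measurable)
  then show ?thesis
    using assms(2,3) by (intro square_root_alternative arm_increasing) auto
qed

text \<open>As the split point moves to the right, the left half becomes likely. Where this first
  happens, the half shorter by one site is still unlikely, so by the square root trick the right
  half is likely.\<close>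

lemma arm_halves:
  assumes "prob {\<sigma>. arm h c k UNIV r \<sigma>} \<ge> 1 - \<delta>\<^sup>2" "0 < \<delta>" "\<delta> < 1"
  shows "\<exists>\<xi>. prob {\<sigma>. arm h c k {..\<xi>} r \<sigma>} \<ge> 1 - \<delta> \<and> prob {\<sigma>. arm h c k {\<xi>..} r \<sigma>} \<ge> 1 - \<delta>"
proof -
  let ?f = "\<lambda>I. prob {\<sigma>. arm h c k I r \<sigma>}"
  \<comment> \<open>Strictness lets a half-line with a large finite end replace the whole
    side.\<close>
  have "\<delta>\<^sup>2 < \<delta>" using assms(2,3) by (simp add: power2_eq_square)
  then have U: "?f UNIV > 1 - \<delta>" using assms(1) by simp
  have mono: "?f I \<le> ?f J" if "I \<subseteq> J" for I J
    by (rule prob_Collect_mono) (use that in \<open>auto simp: arm_def\<close>)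
  have exhaust: "\<exists>n. ?f (J n) \<ge> 1 - \<delta>" if "incseq J" "(\<Union>n. J n) = UNIV" for J :: "nat \<Rightarrow> int set"
  proof -
    have "(\<lambda>n. ?f (J n)) \<longlonglongrightarrow> prob (\<Union>n. {\<sigma>. arm h c k (J n) r \<sigma>})"
    proof (rule finite_Lim_measure_incseq)
      show "range (\<lambda>n. {\<sigma>. arm h c k (J n) r \<sigma>}) \<subseteq> events" by (auto intro!: sets_Collect_pred)
      show "incseq (\<lambda>n. {\<sigma>. arm h c k (J n) r \<sigma>})"
        using that(1) by (fastforce simp: incseq_def arm_def)
    qed
    moreover have "(\<Union>n. {\<sigma>. arm h c k (J n) r \<sigma>}) = {\<sigma>. arm h c k UNIV r \<sigma>}"
      using that(2) unfolding arm_def by blast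
    ultimately have "(\<lambda>n. ?f (J n)) \<longlonglongrightarrow> ?f UNIV" by simp
    from order_tendstoD(1)[OF this U] show ?thesis
      by (auto simp: eventually_sequentially intro: less_imp_le)
  qed
  obtain m where m: "?f {- int m..} \<ge> 1 - \<delta>"
  proof -
    have "(\<Union>n. {- int n..}) = UNIV"
    proof -
      have "x \<in> {- int (nat \<bar>x\<bar>)..}" for x by simp
      then show ?thesis by blast
    qed
    then show ?thesis using exhaust[of "\<lambda>n. {- int n..}"] that by (auto simp: incseq_def)
  qed
  obtain n where n: "?f {..int n} \<ge> 1 - \<delta>"
  proof -
    have "(\<Union>n. {..int n}) = UNIV"
    proof -
      have "x \<in> {..int (nat \<bar>x\<bar>)}" for x by simp
      then show ?thesis by blast
    qed
    then show ?thesis using exhaust[of "\<lambda>n. {..int n}"] that by (auto simp: incseq_def)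
  qed
  show ?thesis
  proof (cases "?f {..- int m} \<ge> 1 - \<delta>")
    case True then show ?thesis using m by blast
  next
    case False
    have "\<exists>\<xi>. \<not> ?f {..\<xi>} \<ge> 1 - \<delta> \<and> ?f {..\<xi> + 1} \<ge> 1 - \<delta>"
    proof (rule ccontr)
      assume no: "\<not> ?thesis"
      have "\<not> ?f {..x} \<ge> 1 - \<delta>" if "- int m \<le> x" for x
        using that by (induction x rule: int_ge_induct) (use False no in auto)
      from this[of "int n"] show False using n by simp
    qed
    then obtain \<xi> where \<xi>: "\<not> ?f {..\<xi>} \<ge> 1 - \<delta>" "?f {..\<xi> + 1} \<ge> 1 - \<delta>" by blast
    have "arm h c k UNIV r \<sigma> \<longleftrightarrow> arm h c k {..\<xi>} r \<sigma> \<or> arm h c k {\<xi> + 1..} r \<sigma>" for \<sigma>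
    proof -
      have "x \<in> {..\<xi>} \<or> x \<in> {\<xi> + 1..}" for x by auto
      then show ?thesis unfolding arm_def by blast
    qed
    then have "?f {..\<xi>} \<ge> 1 - \<delta> \<or> ?f {\<xi> + 1..} \<ge> 1 - \<delta>"
      using assms(1,2) by (intro square_root_alternative arm_increasing) auto
    then show ?thesis using \<xi> by blast
  qed
qed

text \<open>Here \<open>r\<close> is \<open>0\<close> or \<open>h\<close>, so that row
  \<open>h - r\<close> is the opposite side. Twice \<open>T\<close> is the least width of the gap
  between the two prongs, which may be joined to each other anywhere in the strip.\<close>

definition fork :: "int \<Rightarrow> int \<Rightarrow> int \<Rightarrow> int \<Rightarrow> config \<Rightarrow> bool" where
  "fork h r T \<xi> \<sigma> \<longleftrightarrow> (\<exists>b1 b2 t. b1 \<le> \<xi> - T \<and> \<xi> + T \<le> b2 \<and>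
     conn (strip h) \<sigma> (b1, r) (b2, r) \<and> conn (strip h) \<sigma> (b1, r) (t, h - r))"

definition local_crossing :: "int \<Rightarrow> int \<Rightarrow> int \<Rightarrow> config \<Rightarrow> bool" where
  "local_crossing h r L \<sigma> \<longleftrightarrow> (\<exists>b t. \<bar>b\<bar> \<le> L \<and> conn (strip h) \<sigma> (b, r) (t, h - r))"

lemma fork_measurable [measurable]: "Measurable.pred \<rho> (fork h r T \<xi>)"
  unfolding fork_def by measurable

lemma local_crossing_measurable [measurable]: "Measurable.pred \<rho> (local_crossing h r L)"
  unfolding local_crossing_def by measurable

text \<open>The split point from \<open>arm_halves\<close> is uncontrolled and may differ between
  the two types. Moving it to \<open>0\<close> makes their forks comparable.\<close>

lemma prob_fork: "prob {\<sigma>. fork h r T \<xi> \<sigma>} = prob {\<sigma>. fork h r T 0 \<sigma>}"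
proof -
  have "fork h r T 0 (translate (\<xi>, 0) \<sigma>) \<longleftrightarrow> fork h r T \<xi> \<sigma>" for \<sigma>
  proof
    assume "fork h r T 0 (translate (\<xi>, 0) \<sigma>)"
    then obtain b1 b2 t where "b1 + \<xi> \<le> \<xi> - T" "\<xi> + T \<le> b2 + \<xi>"
      "conn (strip h) \<sigma> (b1 + \<xi>, r) (b2 + \<xi>, r)" "conn (strip h) \<sigma> (b1 + \<xi>, r) (t + \<xi>, h - r)"
      unfolding fork_def conn_strip_translate by auto
    then show "fork h r T \<xi> \<sigma>" unfolding fork_def by blast
  next
    assume "fork h r T \<xi> \<sigma>"
    then obtain b1 b2 t where "b1 \<le> \<xi> - T" "\<xi> + T \<le> b2"
      "conn (strip h) \<sigma> (b1, r) (b2, r)" "conn (strip h) \<sigma> (b1, r) (t, h - r)"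
      unfolding fork_def by blast
    then have "b1 - \<xi> \<le> 0 - T" "0 + T \<le> b2 - \<xi>"
      "conn (strip h) \<sigma> (b1 - \<xi> + \<xi>, r) (b2 - \<xi> + \<xi>, r)" "conn (strip h) \<sigma> (b1 - \<xi> + \<xi>, r) (t - \<xi> + \<xi>, h - r)"
      by simp_all
    then show "fork h r T 0 (translate (\<xi>, 0) \<sigma>)" unfolding fork_def conn_strip_translate by blast
  qed
  then show ?thesis using prob_translate_Collect[of "fork h r T 0" "(\<xi>, 0)"] by simp
qed

text \<open>Since \<open>square (0, y) K\<close> lies strictly between the two sides, both arms
  leave it, and local uniqueness joins them inside the strip.\<close>

lemma join_arms:
  assumes LU: "locally_unique k K (0, y) \<sigma>" and K: "K < y" "K < h - y"
    and s: "s \<in> square (0, y) k" "conn (strip h) \<sigma> s (a, p)" "p = 0 \<or> p = h"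
    and t: "t \<in> square (0, y) k" "conn (strip h) \<sigma> t (b, q)" "q = 0 \<or> q = h"
  shows "conn (strip h) \<sigma> (a, p) (b, q)"
proof -
  have "conn (square (0, y) K) \<sigma> s t"
  proof -
    have "(a, p) \<notin> square (0, y) K" "(b, q) \<notin> square (0, y) K" using K s(3) t(3) by (auto simp: square_def)
    moreover have "conn UNIV \<sigma> s (a, p)" "conn UNIV \<sigma> t (b, q)" using s(2) t(2) conn_mono by blast+
    ultimately show ?thesis using LU s(1) t(1) unfolding locally_unique_def by blast
  qed
  then have "conn (strip h) \<sigma> s t" by (rule conn_mono) (use K in \<open>auto simp: square_def strip_def\<close>)
  then show ?thesis using s(2) t(2) conn_sym con_trans by metis
qed

text \<open>The site \<open>u\<close> lies beyond side \<open>q\<close>, and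
  \<open>square (0, y) K\<close> does not reach side \<open>r\<close>. So the path that local
  uniqueness provides inside this square crosses side \<open>q\<close>, at a column within
  \<open>K\<close> of the centre.\<close>

lemma reach_near_side:
  assumes LU: "locally_unique k K (0, y) \<sigma>"
    and e: "r = 0 \<and> q = h \<and> K < y \<and> h < snd u \<or> r = h \<and> q = 0 \<and> K < h - y \<and> snd u < 0"
    and s: "s \<in> square (0, y) k" "conn (strip h) \<sigma> s (a, r)"
    and u: "u \<in> square (0, y) k" "inf_conn UNIV \<sigma> u"
  shows "\<exists>t. \<bar>t\<bar> \<le> K \<and> conn (strip h) \<sigma> (t, q) (a, r)"
proof -
  have "conn (square (0, y) K) \<sigma> s u"
  proof -
    have "(a, r) \<notin> square (0, y) K" using e by (auto simp: square_def)
    moreover have "conn UNIV \<sigma> s (a, r)" using s(2) conn_mono by blast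
    moreover have "\<not> {z. conn UNIV \<sigma> u z} \<subseteq> square (0, y) K"
      using u(2) finite_subset[OF _ finite_square] by blast
    ultimately show ?thesis using LU s(1) u(1) unfolding locally_unique_def by blast
  qed
  moreover have "s \<in> strip h" using con_in1[OF s(2)] by blast
  moreover have "\<not> con R (\<sigma> -` {v} \<inter> square (0, y) K \<inter> strip h) s u"
  proof
    assume "con R (\<sigma> -` {v} \<inter> square (0, y) K \<inter> strip h) s u"
    from con_in2[OF this] have "u \<in> strip h" by blast
    then show False using e by (auto simp: strip_def)
  qed
  ultimately obtain w w' where w: "con R (\<sigma> -` {v} \<inter> square (0, y) K \<inter> strip h) s w"
    "w' \<in> \<sigma> -` {v} \<inter> square (0, y) K - strip h" "R w w'" by (rule con_exitE)
  have "w \<in> square (0, y) K" "w \<in> strip h" using con_in2[OF w(1)] by auto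
  then have "snd w = q" "\<bar>fst w\<bar> \<le> K"
    using e w(2) R_square[OF w(3)] by (auto simp: square_def strip_def)
  moreover have "conn (strip h) \<sigma> s w" using w(1) by (rule con_mono) auto
  then have "conn (strip h) \<sigma> w (a, r)" using s(2) conn_sym con_trans by metis
  ultimately show ?thesis by (intro exI[of _ "fst w"]) (metis prod.collapse)
qed

subsection \<open>Forks in strips\<close>

text \<open>Shifting the square by \<open>T\<close> to the left and to the right carries the two
  halves along; this opens the gap of the fork.\<close>

lemma prob_half_arm:
  assumes "prob {\<sigma>. arm h (0, y) k {..\<xi>} r \<sigma>} \<ge> 1 - \<delta>" "prob {\<sigma>. arm h (0, y) k {\<xi>..} r \<sigma>} \<ge> 1 - \<delta>"
  shows "prob {\<sigma>. arm h (- T, y) k {..\<xi> - T} r \<sigma>} \<ge> 1 - \<delta>"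
    and "prob {\<sigma>. arm h (T, y) k {\<xi> + T..} r \<sigma>} \<ge> 1 - \<delta>"
proof -
  have "{z. z + - T \<in> {..\<xi> - T}} = {..\<xi>}" "{z. z + T \<in> {\<xi> + T..}} = {\<xi>..}" by auto
  then show "prob {\<sigma>. arm h (- T, y) k {..\<xi> - T} r \<sigma>} \<ge> 1 - \<delta>"
    "prob {\<sigma>. arm h (T, y) k {\<xi> + T..} r \<sigma>} \<ge> 1 - \<delta>"
    using prob_arm_translate[of h 0 "- T" y k "{..\<xi> - T}" r] prob_arm_translate[of h 0 T y k "{\<xi> + T..}" r] assms
    by simp_all
qed

text \<open>Two arms to side \<open>r\<close> and one to the opposite side are joined in the middle.
  The side that is split needs the stronger bound, as the splitting costs a square root. Four events
  fail with probability at most \<open>\<delta>\<close> each; the 5 is for agreement with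
  \<open>prob_fork_near_side\<close>.\<close>

lemma prob_fork_middle:
  assumes \<delta>: "0 < \<delta>" "\<delta> < 1" and T: "0 \<le> T"
    and LU: "prob {\<sigma>. locally_unique (k + T + 1) K (0, y) \<sigma>} \<ge> 1 - \<delta>"
    and y: "K < y" "K < h - y" "\<bar>y1 - y\<bar> \<le> 1" "\<bar>y2 - y\<bar> \<le> 1"
    and r: "r = 0 \<or> r = h"
    and arms: "prob {\<sigma>. arm h (0, y1) k UNIV r \<sigma>} \<ge> 1 - \<delta>\<^sup>2"
      "prob {\<sigma>. arm h (0, y2) k UNIV (h - r) \<sigma>} \<ge> 1 - \<delta>"
  shows "prob {\<sigma>. fork h r T 0 \<sigma>} \<ge> 1 - 5 * \<delta>"
proof -
  obtain \<xi> where \<xi>: "prob {\<sigma>. arm h (0, y1) k {..\<xi>} r \<sigma>} \<ge> 1 - \<delta>" "prob {\<sigma>. arm h (0, y1) k {\<xi>..} r \<sigma>} \<ge> 1 - \<delta>"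
    using arm_halves[OF arms(1) \<delta>] by blast
  note half = prob_half_arm[OF \<xi>, of T]
  let ?P = "\<lambda>\<sigma>. arm h (- T, y1) k {..\<xi> - T} r \<sigma> \<and> arm h (T, y1) k {\<xi> + T..} r \<sigma>"
  let ?Q = "\<lambda>\<sigma>. arm h (0, y2) k UNIV (h - r) \<sigma> \<and> locally_unique (k + T + 1) K (0, y) \<sigma>"
  have P: "prob {\<sigma>. ?P \<sigma>} \<ge> (1 - \<delta>) + (1 - \<delta>) - 1"
    by (rule prob_Collect_conj_ge[OF _ _ half]) measurable
  have Q: "prob {\<sigma>. ?Q \<sigma>} \<ge> (1 - \<delta>) + (1 - \<delta>) - 1"
    by (rule prob_Collect_conj_ge[OF _ _ arms(2) LU]) measurable
  have PQ: "prob {\<sigma>. ?P \<sigma> \<and> ?Q \<sigma>} \<ge> ((1 - \<delta>) + (1 - \<delta>) - 1) + ((1 - \<delta>) + (1 - \<delta>) - 1) - 1"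
    by (rule prob_Collect_conj_ge[OF _ _ P Q]) measurable
  also have "prob {\<sigma>. ?P \<sigma> \<and> ?Q \<sigma>} \<le> prob {\<sigma>. fork h r T \<xi> \<sigma>}"
  proof (rule prob_Collect_mono)
    fix \<sigma> assume *: "?P \<sigma> \<and> ?Q \<sigma>"
    obtain s1 b1 where 1: "s1 \<in> square (- T, y1) k" "b1 \<le> \<xi> - T" "conn (strip h) \<sigma> s1 (b1, r)"
      using conjunct1[OF conjunct1[OF *]] unfolding arm_def by blast
    obtain s2 b2 where 2: "s2 \<in> square (T, y1) k" "\<xi> + T \<le> b2" "conn (strip h) \<sigma> s2 (b2, r)"
      using conjunct2[OF conjunct1[OF *]] unfolding arm_def by blast
    obtain s3 t where 3: "s3 \<in> square (0, y2) k" "conn (strip h) \<sigma> s3 (t, h - r)"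
      using conjunct1[OF conjunct2[OF *]] unfolding arm_def by blast
    \<comment> \<open>The radius \<open>k + T + 1\<close> covers squares of radius \<open>k\<close>
      displaced by \<open>T\<close> horizontally and by one vertically.\<close>
    have sq: "s1 \<in> square (0, y) (k + T + 1)" "s2 \<in> square (0, y) (k + T + 1)" "s3 \<in> square (0, y) (k + T + 1)"
      using square_subset[of "(- T, y1)" "(0, y)" k "k + T + 1"] square_subset[of "(T, y1)" "(0, y)" k "k + T + 1"]
        square_subset[of "(0, y2)" "(0, y)" k "k + T + 1"] 1(1) 2(1) 3(1) y(3,4) T by auto
    have LU: "locally_unique (k + T + 1) K (0, y) \<sigma>" using * by blast
    have rr: "h - r = 0 \<or> h - r = h" using r by auto
    have "conn (strip h) \<sigma> (b1, r) (b2, r)"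
      by (rule join_arms[OF LU y(1,2) sq(1) 1(3) r sq(2) 2(3) r])
    moreover have "conn (strip h) \<sigma> (b1, r) (t, h - r)"
      by (rule join_arms[OF LU y(1,2) sq(1) 1(3) r sq(3) 3(2) rr])
    ultimately show "fork h r T \<xi> \<sigma>" using 1 2 unfolding fork_def by blast
  qed measurable
  finally show ?thesis using \<delta>(1) prob_fork[of h r T \<xi>] by simp
qed

text \<open>Local uniqueness is used at two scales. Radius \<open>K\<close> stays inside the strip
  and forms the fork. Radius \<open>L\<close> is used across the near side, to join the fork to a
  square outside the strip that meets an infinite cluster; this produces the end within
  \<open>L\<close>. Two half arms, two uniqueness events and one hit make up
  \<open>5 * \<delta>\<close>.\<close>

lemma prob_fork_near_side:
  assumes \<delta>: "0 < \<delta>" "\<delta> < 1" and T: "0 \<le> T"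
    and LU: "prob {\<sigma>. locally_unique (k + T + 1) K (0, y) \<sigma>} \<ge> 1 - \<delta>" "K < y" "K < h - y"
    and LU': "prob {\<sigma>. locally_unique k' L (0, y) \<sigma>} \<ge> 1 - \<delta>" "k + T + 1 \<le> k'"
    and r: "r = 0 \<and> L < y \<and> h < y' - k \<or> r = h \<and> L < h - y \<and> y' + k < 0"
    and y': "\<bar>y' - y\<bar> + k \<le> k'"
    and arms: "prob {\<sigma>. arm h (0, y) k UNIV r \<sigma>} \<ge> 1 - \<delta>\<^sup>2"
    and hits: "prob {\<sigma>. hits (0, y') k \<sigma>} \<ge> 1 - \<delta>"
  shows "prob {\<sigma>. fork h r T 0 \<sigma>} \<ge> 1 - 5 * \<delta>" "prob {\<sigma>. local_crossing h (h - r) L \<sigma>} \<ge> 1 - 5 * \<delta>"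
proof -
  obtain \<xi> where \<xi>: "prob {\<sigma>. arm h (0, y) k {..\<xi>} r \<sigma>} \<ge> 1 - \<delta>" "prob {\<sigma>. arm h (0, y) k {\<xi>..} r \<sigma>} \<ge> 1 - \<delta>"
    using arm_halves[OF arms \<delta>] by blast
  note half = prob_half_arm[OF \<xi>, of T]
  let ?P = "\<lambda>\<sigma>. arm h (- T, y) k {..\<xi> - T} r \<sigma> \<and> arm h (T, y) k {\<xi> + T..} r \<sigma>"
  let ?Q = "\<lambda>\<sigma>. locally_unique k' L (0, y) \<sigma> \<and> locally_unique (k + T + 1) K (0, y) \<sigma>"
  let ?A = "\<lambda>\<sigma>. (?P \<sigma> \<and> ?Q \<sigma>) \<and> hits (0, y') k \<sigma>"
  have P: "prob {\<sigma>. ?P \<sigma>} \<ge> (1 - \<delta>) + (1 - \<delta>) - 1"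
    by (rule prob_Collect_conj_ge[OF _ _ half]) measurable
  have Q: "prob {\<sigma>. ?Q \<sigma>} \<ge> (1 - \<delta>) + (1 - \<delta>) - 1"
    by (rule prob_Collect_conj_ge[OF _ _ LU'(1) LU(1)]) measurable
  have PQ: "prob {\<sigma>. ?P \<sigma> \<and> ?Q \<sigma>} \<ge> ((1 - \<delta>) + (1 - \<delta>) - 1) + ((1 - \<delta>) + (1 - \<delta>) - 1) - 1"
    by (rule prob_Collect_conj_ge[OF _ _ P Q]) measurable
  have "prob {\<sigma>. ?A \<sigma>} \<ge> (((1 - \<delta>) + (1 - \<delta>) - 1) + ((1 - \<delta>) + (1 - \<delta>) - 1) - 1) + (1 - \<delta>) - 1"
    by (rule prob_Collect_conj_ge[OF _ _ PQ hits]) measurable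
  then have A: "prob {\<sigma>. ?A \<sigma>} \<ge> 1 - 5 * \<delta>" by simp
  have det: "fork h r T \<xi> \<sigma> \<and> local_crossing h (h - r) L \<sigma>" if *: "?A \<sigma>" for \<sigma>
  proof -
    obtain s1 b1 where 1: "s1 \<in> square (- T, y) k" "b1 \<le> \<xi> - T" "conn (strip h) \<sigma> s1 (b1, r)"
      using conjunct1[OF conjunct1[OF conjunct1[OF *]]] unfolding arm_def by blast
    obtain s2 b2 where 2: "s2 \<in> square (T, y) k" "\<xi> + T \<le> b2" "conn (strip h) \<sigma> s2 (b2, r)"
      using conjunct2[OF conjunct1[OF conjunct1[OF *]]] unfolding arm_def by blast
    obtain u where u: "u \<in> square (0, y') k" "inf_conn UNIV \<sigma> u"
      using conjunct2[OF *] unfolding hits_def by blast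
    have sq: "s1 \<in> square (0, y) (k + T + 1)" "s2 \<in> square (0, y) (k + T + 1)" "s1 \<in> square (0, y) k'"
      "u \<in> square (0, y) k'"
      using square_subset[of "(- T, y)" "(0, y)" k "k + T + 1"] square_subset[of "(T, y)" "(0, y)" k "k + T + 1"]
        square_subset[of "(- T, y)" "(0, y)" k k'] square_subset[of "(0, y')" "(0, y)" k k'] 1(1) 2(1) u(1) T LU'(2) y'
      by auto
    have LU1: "locally_unique (k + T + 1) K (0, y) \<sigma>" and LU2: "locally_unique k' L (0, y) \<sigma>" using * by blast+
    have rr: "r = 0 \<or> r = h" using r by blast
    have b: "conn (strip h) \<sigma> (b1, r) (b2, r)"
      by (rule join_arms[OF LU1 LU(2,3) sq(1) 1(3) rr sq(2) 2(3) rr])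
    have "r = 0 \<and> h - r = h \<and> L < y \<and> h < snd u \<or> r = h \<and> h - r = 0 \<and> L < h - y \<and> snd u < 0"
      using r u(1) by (auto simp: square_def)
    from reach_near_side[OF LU2 this sq(3) 1(3) sq(4) u(2)]
    obtain t where t: "\<bar>t\<bar> \<le> L" "conn (strip h) \<sigma> (t, h - r) (b1, r)" by blast
    have "fork h r T \<xi> \<sigma>" unfolding fork_def using 1(2) 2(2) b t(2) conn_sym by blast
    moreover have "local_crossing h (h - r) L \<sigma>" unfolding local_crossing_def using t by auto
    ultimately show ?thesis ..
  qed
  have "prob {\<sigma>. ?A \<sigma>} \<le> prob {\<sigma>. fork h r T \<xi> \<sigma>}"
    by (rule prob_Collect_mono) (measurable, use det in blast)
  with A show "prob {\<sigma>. fork h r T 0 \<sigma>} \<ge> 1 - 5 * \<delta>" using prob_fork[of h r T \<xi>] by simp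
  have "prob {\<sigma>. ?A \<sigma>} \<le> prob {\<sigma>. local_crossing h (h - r) L \<sigma>}"
    by (rule prob_Collect_mono) (measurable, use det in blast)
  with A show "prob {\<sigma>. local_crossing h (h - r) L \<sigma>} \<ge> 1 - 5 * \<delta>" by simp
qed

definition likely :: "real \<Rightarrow> (config \<Rightarrow> bool) \<Rightarrow> bool" where
  "likely \<epsilon> P \<longleftrightarrow> prob {\<sigma>. P \<sigma>} \<ge> 1 - \<epsilon>"

lemma strip_alternatives:
  assumes inf: "AE \<sigma> in \<rho>. \<exists>x. inf_conn UNIV \<sigma> x"
    and \<delta>: "0 < \<delta>" "\<delta> < 1" and T: "0 \<le> T"
  shows "\<exists>L h0. 0 \<le> L \<and> (\<forall>h\<ge>h0.
    likely (5 * \<delta>) (fork h 0 T 0) \<and> likely (5 * \<delta>) (local_crossing h h L) \<or>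
    likely (5 * \<delta>) (fork h h T 0) \<and> likely (5 * \<delta>) (local_crossing h 0 L) \<or>
    likely (5 * \<delta>) (fork h 0 T 0) \<and> likely (5 * \<delta>) (fork h h T 0))"
proof -
  \<comment> \<open>A fourth power, because the square root trick is applied twice: to choose a side
    and to split it.\<close>
  have "0 < (\<delta>\<^sup>2)\<^sup>2" using \<delta>(1) by simp
  from prob_hits[OF inf this] obtain k where k: "0 \<le> k" "\<And>c. prob {\<sigma>. hits c k \<sigma>} \<ge> 1 - (\<delta>\<^sup>2)\<^sup>2" by blast
  have sq: "x\<^sup>2 \<le> x" if "0 \<le> x" "x \<le> 1" for x :: real using that by (simp add: power2_eq_square mult_left_le)
  have d2: "\<delta>\<^sup>2 \<le> \<delta>" "(\<delta>\<^sup>2)\<^sup>2 \<le> \<delta>\<^sup>2" using \<delta> by (auto intro!: sq power_le_one)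
  have hits: "prob {\<sigma>. hits c k \<sigma>} \<ge> 1 - \<delta>" for c using k(2)[of c] d2 by linarith
  obtain K where K: "K \<ge> 0" "\<And>c. prob {\<sigma>. locally_unique (k + T + 1) K c \<sigma>} \<ge> 1 - \<delta>"
    using prob_locally_unique[OF \<delta>(1)] by blast
  \<comment> \<open>At distance \<open>C\<close> from both sides there is room for the squares of
    radius \<open>k\<close> and of radius \<open>K\<close>.\<close>
  define C where "C = K + k + 2"
  \<comment> \<open>Seen from a centre at distance \<open>C\<close> inside a side, this radius
    covers a square of radius \<open>k\<close> centred \<open>k + 1\<close> beyond that side. As it
    does not involve \<open>h\<close>, neither does \<open>L\<close>.\<close>
  define k' where "k' = C + 2 * k + T + 2"
  obtain L where L: "L \<ge> 0" "\<And>c. prob {\<sigma>. locally_unique k' L c \<sigma>} \<ge> 1 - \<delta>"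
    using prob_locally_unique[OF \<delta>(1)] by blast
  have "likely (5 * \<delta>) (fork h 0 T 0) \<and> likely (5 * \<delta>) (local_crossing h h L) \<or>
    likely (5 * \<delta>) (fork h h T 0) \<and> likely (5 * \<delta>) (local_crossing h 0 L) \<or>
    likely (5 * \<delta>) (fork h 0 T 0) \<and> likely (5 * \<delta>) (fork h h T 0)" if h: "h \<ge> 2 * C + L + 1" for h
  proof -
    let ?A = "\<lambda>r y. prob {\<sigma>. arm h (0, y) k UNIV r \<sigma>} \<ge> 1 - \<delta>\<^sup>2"
    have C: "K < C" "k < C" "0 \<le> C" using k K C_def by auto
    have alt: "?A 0 y \<or> ?A h y" if "C \<le> y" "y \<le> h - C" for y
    proof (rule arm_to_some_side[OF _ k(2)])
      show "square (0, y) k \<subseteq> strip h" using that C by (auto simp: square_def strip_def)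
    qed (use \<delta> in simp)
    consider "?A 0 (h - C)" | "?A h C" | "?A 0 C" "\<not> ?A 0 (h - C)"
      using alt[of C] h C L by auto
    then show ?thesis
    proof cases
      case 1
      \<comment> \<open>The square just below the upper side reaches the lower side; the square
        centred at height \<open>h + k + 1\<close> lies entirely above the strip.\<close>
      have "likely (5 * \<delta>) (fork h 0 T 0)" "likely (5 * \<delta>) (local_crossing h (h - 0) L)"
        unfolding likely_def
        by (rule prob_fork_near_side[OF \<delta> T K(2) _ _ L(2) _ _ _ 1 hits[of "(0, h + k + 1)"]];
            use C h k K L T k'_def in simp)+
      then show ?thesis by simp
    next
      case 2
      have "likely (5 * \<delta>) (fork h h T 0)" "likely (5 * \<delta>) (local_crossing h (h - h) L)"
        unfolding likely_def
        by (rule prob_fork_near_side[OF \<delta> T K(2) _ _ L(2) _ _ _ 2 hits[of "(0, - k - 1)"]];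
            use C h k K L T k'_def in simp)+
      then show ?thesis by simp
    next
      case 3
      \<comment> \<open>Discrete continuity: at some height the lower side is likely, and one step
        higher it is not, so there \<open>alt\<close> gives the upper side. This is why
        \<open>prob_fork_middle\<close> admits two heights near \<open>y\<close>.\<close>
      have "\<exists>y. C \<le> y \<and> y < h - C \<and> ?A 0 y \<and> \<not> ?A 0 (y + 1)"
      proof (rule ccontr)
        assume no: "\<not> ?thesis"
        have "y \<le> h - C \<longrightarrow> ?A 0 y" if "C \<le> y" for y
          using that
        proof (induction y rule: int_ge_induct)
          case base then show ?case using 3(1) by blast
        next
          case (step i)
          then show ?case using no by auto
        qed
        from this[of "h - C"] show False using 3(2) h C L by auto
      qed
      then obtain y where y: "C \<le> y" "y < h - C" "?A 0 y" "\<not> ?A 0 (y + 1)" by blast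
      have y1: "?A h (y + 1)" using alt[of "y + 1"] y by auto
      have weak: "prob {\<sigma>. arm h (0, y) k UNIV 0 \<sigma>} \<ge> 1 - \<delta>" "prob {\<sigma>. arm h (0, y + 1) k UNIV h \<sigma>} \<ge> 1 - \<delta>"
        using y(3) y1 d2 by linarith+
      have "likely (5 * \<delta>) (fork h 0 T 0)"
        unfolding likely_def
        by (rule prob_fork_middle[OF \<delta> T K(2), of y _ y "y + 1"]) (use C y weak in simp_all)
      moreover have "likely (5 * \<delta>) (fork h h T 0)"
        unfolding likely_def
        by (rule prob_fork_middle[OF \<delta> T K(2), of y _ "y + 1" y]) (use C y y1 weak in simp_all)
      ultimately show ?thesis by blast
    qed
  qed
  then show ?thesis using L(1) by blast
qed

end

section \<open>Coexistence\<close>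

text \<open>Symmetry makes the \<open>con\<close> class of a site connected within itself, and it
  absorbs every connected set containing that site; so the infinite classes are infinite
  clusters.\<close>

lemma infinite_cluster_iff:
  assumes "symp R"
  shows "(\<exists>C. maximal_connected R T C \<and> infinite C) \<longleftrightarrow> (\<exists>x. infinite {y. con R T x y})"
proof
  assume "\<exists>C. maximal_connected R T C \<and> infinite C"
  then obtain C where C: "C \<subseteq> T" "connected_wrt R C" "infinite C" unfolding maximal_connected_def by blast
  obtain x where x: "x \<in> C" using C(3) by (metis finite.emptyI ex_in_conv)
  have "con R C x y" if "y \<in> C" for y
    using C(2) x that by (auto simp: connected_wrt_def con_def)
  then have "C \<subseteq> {y. con R T x y}" using con_mono[OF _ C(1)] by blast
  then have "infinite {y. con R T x y}" using C(3) finite_subset by blast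
  then show "\<exists>x. infinite {y. con R T x y}" ..
next
  assume "\<exists>x. infinite {y. con R T x y}"
  then obtain x where x: "infinite {y. con R T x y}" by blast
  let ?C = "{y. con R T x y}"
  have "?C \<noteq> {}" using x by (metis finite.emptyI)
  then have xT: "x \<in> T" using con_in1 by blast
  have inner: "con R ?C x y" if "con R T x y" for y
    using that
  proof (induction rule: con_induct)
    case refl show ?case using con_refl[OF xT] by (intro con_refl) simp
  next
    case (step u w)
    have "con R T x w" using con_trans[OF step(1) con_step] con_in2[OF step(1)] step(2,3) by blast
    then have "con R ?C u w" using step(1,3) by (intro con_step) auto
    then show ?case using step(4) con_trans by blast
  qed
  have "con R ?C y z" if "y \<in> ?C" "z \<in> ?C" for y z
  proof -
    have "con R ?C y x" by (rule con_sym[OF assms inner]) (use that in simp)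
    also have "con R ?C x z" by (rule inner) (use that in simp)
    finally show ?thesis .
  qed
  then have conn: "connected_wrt R ?C" unfolding connected_wrt_def con_def by blast
  have "D \<subseteq> ?C" if D: "?C \<subseteq> D" "D \<subseteq> T" "connected_wrt R D" for D
  proof
    fix d assume d: "d \<in> D"
    have "x \<in> D" using D(1) con_refl[OF xT] by blast
    then have "con R D x d" using D(3) d unfolding connected_wrt_def con_def by blast
    then show "d \<in> ?C" using con_mono[OF _ D(2)] by blast
  qed
  moreover have "?C \<subseteq> T"
  proof
    fix y assume "y \<in> ?C"
    then show "y \<in> T" using con_in2[of R T x y] by simp
  qed
  ultimately have "maximal_connected R T ?C"
    unfolding maximal_connected_def using conn by (meson subset_antisym)
  then show "\<exists>C. maximal_connected R T C \<and> infinite C" using x by blast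
qed

lemma coexistence_eq:
  "coexistence = {\<sigma>. (\<exists>x. infinite {y. con star_adjacent (\<sigma> -` {True} \<inter> UNIV) x y}) \<and>
     (\<exists>x. infinite {y. con adjacent (\<sigma> -` {False} \<inter> UNIV) x y})}"
  unfolding coexistence_def one_star_cluster_def zero_cluster_def
    infinite_cluster_iff[OF symp_star_adjacent] infinite_cluster_iff[OF symp_adjacent] by simp

section \<open>Incompatible crossings of the two types\<close>

lemma crossings_ordered:
  assumes Z: "con adjacent (Z \<inter> strip h) (b, r) (t, h - r)"
    and W: "con star_adjacent (W \<inter> strip h) (c, r) (u, h - r)"
    and r: "r = 0 \<or> r = h" and "Z \<inter> W = {}"
  shows "b < c \<longleftrightarrow> t < u"
  using r
proof
  assume "r = 0"
  then show ?thesis using strip_crossing[OF _ _ assms(4)] Z W by simp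
next
  assume r: "r = h"
  have "con adjacent (Z \<inter> strip h) (t, 0) (b, h)" "con star_adjacent (W \<inter> strip h) (u, 0) (c, h)"
    using con_sym[OF symp_adjacent Z] con_sym[OF symp_star_adjacent W] r by simp_all
  from strip_crossing[OF this assms(4)] show ?thesis by simp
qed

text \<open>All prongs of one type share its opposite end, \<open>t\<close> or \<open>u\<close>.
  Comparing \<open>b1\<close> with \<open>c2\<close> gives \<open>t < u\<close>, and comparing
  \<open>b2\<close> with \<open>c1\<close> then gives \<open>b2 < c1\<close>.\<close>

lemma crossings_do_not_interlace:
  assumes Z: "con adjacent (Z \<inter> strip h) (b1, r) (b2, r)" "con adjacent (Z \<inter> strip h) (b1, r) (t, h - r)"
    and W: "con star_adjacent (W \<inter> strip h) (c1, r) (c2, r)" "con star_adjacent (W \<inter> strip h) (c1, r) (u, h - r)"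
    and r: "r = 0 \<or> r = h" and disj: "Z \<inter> W = {}" and "b1 < c2" "c1 \<le> b2"
  shows False
proof -
  have Z2: "con adjacent (Z \<inter> strip h) (b2, r) (t, h - r)"
    using con_trans[OF con_sym[OF symp_adjacent Z(1)] Z(2)] .
  have W2: "con star_adjacent (W \<inter> strip h) (c2, r) (u, h - r)"
    using con_trans[OF con_sym[OF symp_star_adjacent W(1)] W(2)] .
  have "t < u" using crossings_ordered[OF Z(2) W2 r disj] assms(7) by blast
  then have "b2 < c1" using crossings_ordered[OF Z2 W(2) r disj] by blast
  then show False using assms(8) by simp
qed

theorem corollary1:
  fixes \<rho> :: "config measure"
  assumes "prob_space \<rho>"
    and "sets \<rho> = sets config_space"
    and "ergodic \<rho>"
    and "positively_associated \<rho>"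
    and "finite_energy \<rho>"
  shows "coexistence \<in> sets \<rho> \<and> measure \<rho> coexistence = 0"
proof -
  interpret percolation \<rho>
    using assms by (intro percolation.intro percolation_axioms.intro)
  interpret zero: percolation_type \<rho> adjacent False
  proof
    show "adjacent (x + a) (y + a) = adjacent x y" for x y a by (simp add: adjacent_iff)
    show "symp adjacent" by (rule symp_adjacent)
    show "star_adjacent x y" if "adjacent x y" for x y using that by (rule adjacent_imp_star_adjacent)
  qed
  interpret one: percolation_type \<rho> star_adjacent True
  proof
    show "star_adjacent (x + a) (y + a) = star_adjacent x y" for x y a by (simp add: star_adjacent_iff)
    show "symp star_adjacent" by (rule symp_star_adjacent)
    show "star_adjacent x y" if "adjacent x y" for x y using that by (rule adjacent_imp_star_adjacent)
  qed
  let ?zero = "\<lambda>\<sigma>. \<exists>x. zero.inf_conn UNIV \<sigma> x" and ?one = "\<lambda>\<sigma>. \<exists>x. one.inf_conn UNIV \<sigma> x"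
  have pred: "Measurable.pred \<rho> (\<lambda>\<sigma>. ?one \<sigma> \<and> ?zero \<sigma>)" by measurable
  have ev: "coexistence \<in> events" unfolding coexistence_eq using pred by (rule sets_Collect_pred)
  have "prob coexistence = 0"
  proof (rule ccontr)
    assume ne: "prob coexistence \<noteq> 0"
    have inv: "?one (translate a \<sigma>) \<and> ?zero (translate a \<sigma>) \<longleftrightarrow> ?one \<sigma> \<and> ?zero \<sigma>" for a \<sigma>
      unfolding one.conn_UNIV_translate(2) zero.conn_UNIV_translate(2)
        all_ex_translate(2)[of "zero.inf_conn UNIV \<sigma>"] all_ex_translate(2)[of "one.inf_conn UNIV \<sigma>"] ..
    have "prob {\<sigma>. ?one \<sigma> \<and> ?zero \<sigma>} = 1"
      using zero_one[OF pred inv] ne unfolding coexistence_eq by blast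
    then have "AE \<sigma> in \<rho>. ?one \<sigma> \<and> ?zero \<sigma>" using prob_eq_1[OF sets_Collect_pred[OF pred]] by simp
    then have AE: "AE \<sigma> in \<rho>. ?one \<sigma>" "AE \<sigma> in \<rho>. ?zero \<sigma>" by (auto elim: eventually_mono)
    \<comment> \<open>With \<open>5 * d = 1 / 4\<close>, two likely events occur together with
      probability at least one half.\<close>
    define d :: real where "d = 1 / 20"
    have d: "0 < d" "d < 1" by (simp_all add: d_def)
    obtain L h1 where L: "0 \<le> L" and one: "\<And>h. h \<ge> h1 \<Longrightarrow>
        one.likely (5 * d) (one.fork h 0 0 0) \<and> one.likely (5 * d) (one.local_crossing h h L) \<or>
        one.likely (5 * d) (one.fork h h 0 0) \<and> one.likely (5 * d) (one.local_crossing h 0 L) \<or>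
        one.likely (5 * d) (one.fork h 0 0 0) \<and> one.likely (5 * d) (one.fork h h 0 0)"
      using one.strip_alternatives[OF AE(1) d order_refl] by blast
    \<comment> \<open>The gap exceeds the window by one, so that \<open>b1 < c\<close> holds
      strictly for every \<open>c\<close> in the window.\<close>
    have T: "0 \<le> L + 1" using L by simp
    obtain h0 where zero: "\<And>h. h \<ge> h0 \<Longrightarrow>
        zero.likely (5 * d) (zero.fork h 0 (L + 1) 0) \<or> zero.likely (5 * d) (zero.fork h h (L + 1) 0)"
      using zero.strip_alternatives[OF AE(2) d T] by blast
    define h where "h = max h0 h1"
    have both: "\<exists>\<sigma>. P \<sigma> \<and> Q \<sigma>"
      if "Measurable.pred \<rho> P" "Measurable.pred \<rho> Q" "zero.likely (5 * d) P" "one.likely (5 * d) Q" for P Q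
    proof (rule ccontr)
      assume "\<not> ?thesis"
      then have "{\<sigma>. P \<sigma> \<and> Q \<sigma>} = {}" by blast
      then have "prob {\<sigma>. P \<sigma> \<and> Q \<sigma>} = 0" by (simp only: measure_empty)
      then show False
        using prob_Collect_conj_ge[OF that(1,2) that(3)[unfolded zero.likely_def] that(4)[unfolded one.likely_def]]
        by (simp add: d_def)
    qed
    have disj: "\<sigma> -` {False} \<inter> \<sigma> -` {True} = {}" for \<sigma> :: config by auto
    have ff: "\<not> (zero.likely (5 * d) (zero.fork h r (L + 1) 0) \<and> one.likely (5 * d) (one.fork h r 0 0))"
      if r: "r = 0 \<or> r = h" for r
    proof
      assume *: "zero.likely (5 * d) (zero.fork h r (L + 1) 0) \<and> one.likely (5 * d) (one.fork h r 0 0)"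
      obtain \<sigma> where f: "zero.fork h r (L + 1) 0 \<sigma>" and g: "one.fork h r 0 0 \<sigma>"
        using both[OF zero.fork_measurable one.fork_measurable conjunct1[OF *] conjunct2[OF *]] by blast
      obtain b1 b2 t where b: "b1 \<le> 0 - (L + 1)" "0 + (L + 1) \<le> b2"
        "zero.conn (strip h) \<sigma> (b1, r) (b2, r)" "zero.conn (strip h) \<sigma> (b1, r) (t, h - r)"
        using f unfolding zero.fork_def by blast
      obtain c1 c2 u where c: "c1 \<le> 0 - 0" "0 + 0 \<le> c2"
        "one.conn (strip h) \<sigma> (c1, r) (c2, r)" "one.conn (strip h) \<sigma> (c1, r) (u, h - r)"
        using g unfolding one.fork_def by blast
      show False
        by (rule crossings_do_not_interlace[OF b(3,4) c(3,4) r disj]) (use b c L in auto)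
    qed
    have fl: "\<not> (zero.likely (5 * d) (zero.fork h r (L + 1) 0) \<and> one.likely (5 * d) (one.local_crossing h r L))"
      if r: "r = 0 \<or> r = h" for r
    proof
      assume *: "zero.likely (5 * d) (zero.fork h r (L + 1) 0) \<and> one.likely (5 * d) (one.local_crossing h r L)"
      obtain \<sigma> where f: "zero.fork h r (L + 1) 0 \<sigma>" and g: "one.local_crossing h r L \<sigma>"
        using both[OF zero.fork_measurable one.local_crossing_measurable conjunct1[OF *] conjunct2[OF *]] by blast
      obtain b1 b2 t where b: "b1 \<le> 0 - (L + 1)" "0 + (L + 1) \<le> b2"
        "zero.conn (strip h) \<sigma> (b1, r) (b2, r)" "zero.conn (strip h) \<sigma> (b1, r) (t, h - r)"
        using f unfolding zero.fork_def by blast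
      obtain c u where c: "\<bar>c\<bar> \<le> L" "one.conn (strip h) \<sigma> (c, r) (u, h - r)"
        using g unfolding one.local_crossing_def by blast
      \<comment> \<open>A single crossing is treated as a fork with both prongs at
        \<open>c\<close>.\<close>
      show False
        by (rule crossings_do_not_interlace[OF b(3,4) con_refl[OF con_in1[OF c(2)]] c(2) r disj]) (use b c in auto)
    qed
    have hh: "h \<ge> h0" "h \<ge> h1" by (auto simp: h_def)
    \<comment> \<open>At the side where the zeros fork, the ones either fork as well or end in their
      window; \<open>ff\<close> and \<open>fl\<close> exclude both.\<close>
    show False using zero[OF hh(1)] one[OF hh(2)] ff[of 0] ff[of h] fl[of 0] fl[of h] by blast
  qed
  with ev show ?thesis by blast
qed

end
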